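(* Assume that $F_1\le F_2\le\cdots\le F_k$ pointwise on $[0,\infty)$ and let $t$ be fixed. For $i=1,\ldots,k$ let $\mathcal S_{it}=\{j: F_j(t)=F_i(t)\}$, $i_*(t)=\min \mathcal S_{it}$ and $i^*(t)=\max \mathcal S_{it}$. Then, as $n\to\infty$, $$(Z_{1n}^*(t),Z_{2n}^*(t),\ldots,Z_{kn}^*(t))^T\ \xrightarrow{d}\ (Z_1^*(t),Z_2^*(t),\ldots,Z_k^*(t))^T,$$ where $$Z_i^*(t)=\max_{i_*(t)\le r\le i}\ \min_{i\le s\le i^*(t)}\ \frac{\sum_{j=r}^{s}Z_j(t)}{s-r+1},\qquad 1\le i\le k.$$
   Context: Competing risks model: $k\ge 3$ is fixed, $(T,\delta)$ is a random pair with $T\ge 0$ having a continuous distribution function $F$, and $\delta\in\{1,\ldots,k\}$. The cumulative incidence functions are $F_j(t)=P[T\le t,\ \delta=j]$, so $F=\sum_{j=1}^k F_j$. One observes i.i.d. copies $(T_i,\delta_i)$, $1\le i\le n$, of $(T,\delta)$. Unrestricted estimators: $\hat F_j(t)=\frac1n\sum_{i=1}^n I(T_i\le t,\ \delta_i=j)$. Restricted estimators: $$\hat F_i^*(t)=\max_{1\le r\le i}\ \min_{i\le s\le k}\ \frac{\sum_{j=r}^{s}\hat F_j(t)}{s-r+1},\quad 1\le i\le k.$$ Processes: $Z_{in}^*=\sqrt n\,[\hat F_i^*-F_i]$. The limit variables are built from a $k$-variate mean-zero Gaussian process $(Z_1,\ldots,Z_k)^T$ with covariance $\mathrm{Cov}(Z_i(s),Z_j(t))=F_i(s)[\delta_{ij}-F_j(t)]$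 for $s\le t$, $1\le i,j\le k$, where $\delta_{ij}$ is the Kronecker delta (this is the weak limit of $(\sqrt n[\hat F_i-F_i])_{i=1}^k$). *)

theory Defs
  imports "HOL-Probability.Probability"
begin

section \<open>Convergence in distribution of finite-dimensional random vectors\<close>

text \<open>
  A random vector with finite coordinate set \<open>I\<close> is a measurable map into
  \<open>Pi\<^sub>M I (\<lambda>_. borel)\<close>, whose elements are extensional: coordinates outside \<open>I\<close> are
  \<open>undefined\<close>. Limits are tested against bounded continuous functions for the product topology
  \<open>powertop_real I\<close> on the same carrier. The limit may live on a different probability space.
  Measurability is part of the definition, because the Bochner integral of a non-measurable
  function is 0 by convention.
\<close>

definition converges_in_distribution ::
  "'i set \<Rightarrow> 'a measure \<Rightarrow> (nat \<Rightarrow> 'a \<Rightarrow> 'i \<Rightarrow> real) \<Rightarrow> 'b measure \<Rightarrow> ('b \<Rightarrow> 'i \<Rightarrow> real) \<Rightarrow> bool"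
  where
  "converges_in_distribution I M X N Y \<longleftrightarrow>
     (\<forall>n. X n \<in> measurable M (\<Pi>\<^sub>M i\<in>I. borel)) \<and>
     Y \<in> measurable N (\<Pi>\<^sub>M i\<in>I. borel) \<and>
     (\<forall>f. continuous_map (powertop_real I) euclideanreal f \<and> bounded (f ` topspace (powertop_real I))
        \<longrightarrow> (\<lambda>n. \<integral>\<omega>. f (X n \<omega>) \<partial>M) \<longlonglongrightarrow> (\<integral>\<omega>. f (Y \<omega>) \<partial>N))"


section \<open>Gaussian processes\<close>

text \<open>Constants count as (degenerate) normal variables, as \<open>normal_density\<close> needs \<open>0 < \<sigma>\<close>.\<close>

definition gaussian_rv :: "'b measure \<Rightarrow> ('b \<Rightarrow> real) \<Rightarrow> bool" where
  "gaussian_rv N X \<longleftrightarrow> X \<in> borel_measurable N \<and>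
     (\<exists>\<mu> \<sigma>. (0 < \<sigma> \<and> distributed N lborel X (normal_density \<mu> \<sigma>)) \<or> (AE \<omega> in N. X \<omega> = \<mu>))"

definition gaussian_process :: "'b measure \<Rightarrow> 'p set \<Rightarrow> ('p \<Rightarrow> 'b \<Rightarrow> real) \<Rightarrow> bool" where
  "gaussian_process N J X \<longleftrightarrow>
     (\<forall>A c. finite A \<and> A \<subseteq> J \<longrightarrow> gaussian_rv N (\<lambda>\<omega>. \<Sum>p\<in>A. c p * X p \<omega>))"

definition covariance :: "'b measure \<Rightarrow> ('b \<Rightarrow> real) \<Rightarrow> ('b \<Rightarrow> real) \<Rightarrow> real" where
  "covariance N X Y =
     (\<integral>\<omega>. (X \<omega> - (\<integral>\<omega>'. X \<omega>' \<partial>N)) * (Y \<omega> - (\<integral>\<omega>'. Y \<omega>' \<partial>N)) \<partial>N)"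


section \<open>Competing risks\<close>

definition cum_incidence :: "'c measure \<Rightarrow> ('c \<Rightarrow> real) \<Rightarrow> ('c \<Rightarrow> nat) \<Rightarrow> nat \<Rightarrow> real \<Rightarrow> real" where
  "cum_incidence P T \<delta> j t = \<P>(\<omega> in P. T \<omega> \<le> t \<and> \<delta> \<omega> = j)"

text \<open>\<open>T i\<close> and \<open>\<delta> i\<close>, for \<open>i \<ge> 1\<close>, are the observations.\<close>

definition emp_cum_incidence ::
  "(nat \<Rightarrow> 'a \<Rightarrow> real) \<Rightarrow> (nat \<Rightarrow> 'a \<Rightarrow> nat) \<Rightarrow> nat \<Rightarrow> nat \<Rightarrow> real \<Rightarrow> 'a \<Rightarrow> real" where
  "emp_cum_incidence T \<delta> n j t \<omega> =
     (1 / real n) * (\<Sum>i=1..n. of_bool (T i \<omega> \<le> t \<and> \<delta> i \<omega> = j))"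

text \<open>
  \<open>max_min_avg a b x i\<close> is the max-min formula at \<open>i\<close> over the index block \<open>{a..b}\<close>; it is
  used for \<open>a \<le> i \<le> b\<close> only, where both index sets are nonempty.
\<close>

definition max_min_avg :: "nat \<Rightarrow> nat \<Rightarrow> (nat \<Rightarrow> real) \<Rightarrow> nat \<Rightarrow> real" where
  "max_min_avg a b x i =
     (MAX r\<in>{a..i}. MIN s\<in>{i..b}. (\<Sum>j=r..s. x j) / (real s - real r + 1))"

definition restricted_estimator ::
  "nat \<Rightarrow> (nat \<Rightarrow> 'a \<Rightarrow> real) \<Rightarrow> (nat \<Rightarrow> 'a \<Rightarrow> nat) \<Rightarrow> nat \<Rightarrow> nat \<Rightarrow> real \<Rightarrow> 'a \<Rightarrow> real" where
  "restricted_estimator k T \<delta> n i t \<omega> =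
     max_min_avg 1 k (\<lambda>j. emp_cum_incidence T \<delta> n j t \<omega>) i"

definition level_set :: "nat \<Rightarrow> (nat \<Rightarrow> real \<Rightarrow> real) \<Rightarrow> real \<Rightarrow> nat \<Rightarrow> nat set" where
  "level_set k F t i = {j \<in> {1..k}. F j t = F i t}"

definition limit_variable ::
  "nat \<Rightarrow> (nat \<Rightarrow> real \<Rightarrow> real) \<Rightarrow> (nat \<Rightarrow> real \<Rightarrow> 'b \<Rightarrow> real) \<Rightarrow> nat \<Rightarrow> real \<Rightarrow> 'b \<Rightarrow> real" where
  "limit_variable k F Z i t \<omega> =
     max_min_avg (Min (level_set k F t i)) (Max (level_set k F t i)) (\<lambda>j. Z j t \<omega>) i"

end

theory Submission
  imports Defs
begin

text \<open>
  The centred and scaled empirical vector at \<open>t\<close> is a normalised sum of i.i.d. bounded vectors whose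
  linear combinations satisfy the one-dimensional central limit theorem. Linear combinations
  determine convergence of the expectations of trigonometric polynomials; by tightness and
  Stone--Weierstrass on large cubes these suffice for all bounded continuous functions
  (Cramer--Wold). The restricted estimator is the max-min formula applied to the vector
  \<open>sqrt n * (F j t - F i t) + w j\<close>, with \<open>w\<close> the empirical vector. While \<open>w\<close> stays in a fixed cube,
  for large \<open>n\<close> the entries below the block of indices tied with \<open>i\<close> are so negative, and those
  above it so large, that averages reaching outside the block affect neither the minimum nor
  the maximum. So the map equals the limiting one on cubes for large \<open>n\<close>, and tightness and
  continuity of the limiting map conclude.
\<close>

text \<open>The i-th restricted estimator is not a fixed function of the scaled errors: the drift
  \<open>sqrt n * (F j t - F i t)\<close> vanishes on the tied block and diverges elsewhere. A
  mapping theorem with a map depending on \<open>n\<close> is therefore needed, and outside a cube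
  all that is left is that a bounded test function costs at most twice its bound times a tail
  probability. The drift is measured from \<open>F i t\<close>, not from \<open>F j t\<close>,
  because the max-min formula commutes only with applying one and the same nondecreasing affine map
  to all entries. On the Gaussian side, \<open>F j t * (of_bool (j = l) - F l t)\<close> is the
  covariance of the indicators of the disjoint events \<open>T \<le> t \<and> \<delta> = j\<close>,
  so every linear combination of the errors has the variance of the same combination of the limit
  variables.\<close>

section \<open>Comparison of expectations and tightness\<close>

text \<open>The integrand of the difference is at most \<open>\<eta>\<close> off \<open>A\<close>,
  and at most \<open>B + C\<close> on it. In the applications \<open>A\<close> is the event that a
  random vector leaves a cube.\<close>

lemma (in prob_space) integral_diff_le:
  fixes f g :: "'a \<Rightarrow> real"
  assumes [measurable]: "f \<in> borel_measurable M" "g \<in> borel_measurable M" "A \<in> sets M"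
    and f: "\<And>\<omega>. \<omega> \<in> space M \<Longrightarrow> \<bar>f \<omega>\<bar> \<le> B" and g: "\<And>\<omega>. \<omega> \<in> space M \<Longrightarrow> \<bar>g \<omega>\<bar> \<le> C"
    and close: "\<And>\<omega>. \<omega> \<in> space M \<Longrightarrow> \<omega> \<notin> A \<Longrightarrow> \<bar>f \<omega> - g \<omega>\<bar> \<le> \<eta>" and "0 \<le> \<eta>"
  shows "\<bar>expectation f - expectation g\<bar> \<le> \<eta> + (B + C) * prob A"
proof -
  have int: "integrable M f" "integrable M g"
    using f g by (auto intro: integrable_const_bound[where B=B] integrable_const_bound[where B=C])
  have "\<bar>expectation f - expectation g\<bar> = \<bar>\<integral>\<omega>. f \<omega> - g \<omega> \<partial>M\<bar>"
    using int by simp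
  also have "\<dots> \<le> (\<integral>\<omega>. \<bar>f \<omega> - g \<omega>\<bar> \<partial>M)"
    by (rule integral_abs_bound)
  also have "\<dots> \<le> (\<integral>\<omega>. \<eta> + (B + C) * indicator A \<omega> \<partial>M)"
  proof (rule integral_mono)
    show "\<bar>f \<omega> - g \<omega>\<bar> \<le> \<eta> + (B + C) * indicator A \<omega>" if "\<omega> \<in> space M" for \<omega>
      using f[OF that] g[OF that] close[OF that] \<open>0 \<le> \<eta>\<close> by (cases "\<omega> \<in> A") auto
  qed (use int in \<open>auto intro!: integrable_real_indicator simp: emeasure_eq_measure\<close>)
  also have "\<dots> = \<eta> + (B + C) * prob A"
    by (simp add: prob_space emeasure_eq_measure)
  finally show ?thesis .
qed

text \<open>Indicators of tails are not continuous, so continuous ramps stand in for them: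
  \<open>h m\<close> is 0 up to absolute value \<open>m\<close> and 1 from \<open>m + 1\<close> on.
  Dominated convergence makes its expectation under the limit small for large \<open>m\<close>, the
  assumed convergence carries this over to \<open>X n\<close> for large \<open>n\<close>, and
  Markov's inequality turns it into a tail bound. A union bound treats all coordinates at
  once.\<close>

lemma tight_of_coordinatewise_limit:
  fixes X :: "nat \<Rightarrow> 'a \<Rightarrow> 'i \<Rightarrow> real"
  assumes "prob_space M" "prob_space N" "finite I"
    and X: "\<And>n i. i \<in> I \<Longrightarrow> (\<lambda>\<omega>. X n \<omega> i) \<in> borel_measurable M"
    and Y: "\<And>i. i \<in> I \<Longrightarrow> (\<lambda>\<omega>. Y \<omega> i) \<in> borel_measurable N"
    and lim: "\<And>i (g :: real \<Rightarrow> real). i \<in> I \<Longrightarrow> continuous_on UNIV g \<Longrightarrow> bounded (range g) \<Longrightarrow>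
        (\<lambda>n. \<integral>\<omega>. g (X n \<omega> i) \<partial>M) \<longlonglongrightarrow> (\<integral>\<omega>. g (Y \<omega> i) \<partial>N)"
    and "0 < \<epsilon>"
  shows "\<exists>R. \<forall>\<^sub>F n in sequentially. measure M {\<omega> \<in> space M. \<exists>i\<in>I. R < \<bar>X n \<omega> i\<bar>} < \<epsilon>"
proof -
  interpret M: prob_space M by fact
  interpret N: prob_space N by fact
  define h where "h m y = min 1 (max 0 (\<bar>y\<bar> - real m))" for m and y :: real
  have h_cont: "continuous_on UNIV (h m)" for m
    unfolding h_def by (intro continuous_intros)
  have h_meas [measurable]: "h m \<in> borel_measurable borel" for m
    using h_cont by (rule borel_measurable_continuous_onI)
  have h_bd: "0 \<le> h m y" "h m y \<le> 1" for m y
    by (auto simp: h_def)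
  have h_bounded: "bounded (range (h m))" for m
    using h_bd by (auto intro!: boundedI[where B=1])
  \<comment> \<open>The summand 1 makes the union bound \<open>card I * e\<close> strictly smaller
    than \<open>\<epsilon>\<close> and covers an empty \<open>I\<close>.\<close>
  define e where "e = \<epsilon> / (real (card I) + 1)"
  have "0 < e" using \<open>0 < \<epsilon>\<close> by (auto simp: e_def)
  have "\<exists>m. (\<integral>\<omega>. h m (Y \<omega> i) \<partial>N) < e" if "i \<in> I" for i
  proof -
    note [measurable] = Y[OF that]
    have "(\<lambda>m. \<integral>\<omega>. h m (Y \<omega> i) \<partial>N) \<longlonglongrightarrow> (\<integral>\<omega>. 0 \<partial>N)"
    proof (rule integral_dominated_convergence[where w="\<lambda>_. 1"])
      show "AE \<omega> in N. (\<lambda>m. h m (Y \<omega> i)) \<longlonglongrightarrow> 0"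
      proof (intro AE_I2 tendsto_eventually)
        fix \<omega>
        obtain m0 :: nat where "\<bar>Y \<omega> i\<bar> \<le> real m0" using real_arch_simple by blast
        then show "\<forall>\<^sub>F m in sequentially. h m (Y \<omega> i) = 0"
          by (auto simp: h_def eventually_sequentially intro!: exI[of _ m0])
      qed
    qed (use h_bd in auto)
    then have "\<forall>\<^sub>F m in sequentially. (\<integral>\<omega>. h m (Y \<omega> i) \<partial>N) < e"
      using order_tendstoD(2) \<open>0 < e\<close> by fastforce
    then show ?thesis by (auto simp: eventually_sequentially)
  qed
  then obtain m where m: "\<And>i. i \<in> I \<Longrightarrow> (\<integral>\<omega>. h (m i) (Y \<omega> i) \<partial>N) < e"
    by metis
  \<comment> \<open>The sum serves as a common upper bound of the levels \<open>m i\<close>; beyond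
    \<open>R\<close> every ramp \<open>h (m i)\<close> has reached 1.\<close>
  define R where "R = real (\<Sum>i\<in>I. m i) + 1"
  have mR: "real (m i) + 1 \<le> R" if "i \<in> I" for i
    using member_le_sum[of i I m] that \<open>finite I\<close> unfolding R_def
    by (metis add_le_cancel_right le0 of_nat_le_iff)
  have "\<forall>\<^sub>F n in sequentially. \<forall>i\<in>I. (\<integral>\<omega>. h (m i) (X n \<omega> i) \<partial>M) < e"
    using order_tendstoD(2)[OF lim[OF _ h_cont h_bounded] m] \<open>finite I\<close>
    by (simp add: eventually_ball_finite_distrib)
  then have "\<forall>\<^sub>F n in sequentially. measure M {\<omega> \<in> space M. \<exists>i\<in>I. R < \<bar>X n \<omega> i\<bar>} < \<epsilon>"
  proof eventually_elim
    case (elim n)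
    have single: "M.prob {\<omega> \<in> space M. R < \<bar>X n \<omega> i\<bar>} \<le> e" if "i \<in> I" for i
    proof -
      note X[OF that, measurable]
      have "M.prob {\<omega> \<in> space M. R < \<bar>X n \<omega> i\<bar>} \<le> M.prob {\<omega> \<in> space M. 1 \<le> h (m i) (X n \<omega> i)}"
        using mR[OF that] by (intro M.finite_measure_mono) (auto simp: h_def)
      also have "\<dots> \<le> (\<integral>\<omega>. h (m i) (X n \<omega> i) \<partial>M) / 1"
        using h_bd by (intro integral_Markov_inequality_measure[where A="space M"])
          (auto intro!: M.integrable_const_bound[where B=1])
      finally show ?thesis using elim that by fastforce
    qed
    have "M.prob {\<omega> \<in> space M. \<exists>i\<in>I. R < \<bar>X n \<omega> i\<bar>} = M.prob (\<Union>i\<in>I. {\<omega> \<in> space M. R < \<bar>X n \<omega> i\<bar>})"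
      by (rule arg_cong[where f=M.prob]) auto
    also have "\<dots> \<le> (\<Sum>i\<in>I. M.prob {\<omega> \<in> space M. R < \<bar>X n \<omega> i\<bar>})"
      using \<open>finite I\<close> X by (intro M.finite_measure_subadditive_finite) auto
    also have "\<dots> \<le> (\<Sum>i\<in>I. e)"
      using single by (rule sum_mono)
    also have "\<dots> < \<epsilon>"
      using \<open>0 < \<epsilon>\<close> by (simp add: e_def field_simps)
    finally show ?case .
  qed
  then show ?thesis by blast
qed

section \<open>Extensional vectors and the topology of the function type\<close>

text \<open>\<open>powertop_real I\<close> lives on extensional functions, whereas the topology of
  the type \<open>'i \<Rightarrow> real\<close> is the product over all indices. Precomposing with
  \<open>restrict\<close> moves a test function from the former to the latter.\<close>

lemma continuous_on_powertop:
  fixes f :: "('i \<Rightarrow> real) \<Rightarrow> real"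
  assumes "continuous_map (powertop_real I) euclideanreal f"
  shows "continuous_on UNIV (\<lambda>x. f (restrict x I))"
proof -
  have "continuous_map euclidean (powertop_real I) (\<lambda>x::'i \<Rightarrow> real. restrict x I)"
    by (auto simp: continuous_map_componentwise)
  from continuous_map_compose[OF this assms] show ?thesis
    by (simp add: o_def)
qed

text \<open>For a countable index type, the product sigma-algebra over all indices is the Borel
  algebra of the product topology, so continuity there gives measurability. A random vector over
  \<open>I\<close> is measurable into this larger product because its remaining coordinates are
  constantly \<open>undefined\<close>.\<close>

lemma measurable_continuous_powertop:
  fixes f :: "('i::countable \<Rightarrow> real) \<Rightarrow> real"
  assumes f: "continuous_map (powertop_real I) euclideanreal f"
    and X: "X \<in> measurable M (\<Pi>\<^sub>M i\<in>I. borel)"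
  shows "(\<lambda>\<omega>. f (X \<omega>)) \<in> borel_measurable M"
proof -
  have "(\<lambda>x. f (restrict x I)) \<in> borel_measurable (Pi\<^sub>M UNIV (\<lambda>_. borel))"
    using borel_measurable_continuous_onI[OF continuous_on_powertop[OF f]]
    by (simp cong: measurable_cong_sets add: sets_PiM_equal_borel)
  moreover have "X \<in> measurable M (Pi\<^sub>M UNIV (\<lambda>_. borel))"
  proof -
    have "(\<lambda>\<omega>. X \<omega> i) \<in> borel_measurable M" for i
    proof (cases "i \<in> I")
      case True
      show ?thesis by (rule measurable_compose[OF X measurable_component_singleton[OF True]])
    next
      case False
      then have "X \<omega> i = undefined" if "\<omega> \<in> space M" for \<omega>
        using measurable_space[OF X that] by (auto simp: space_PiM)
      then show ?thesis by (simp cong: measurable_cong)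
    qed
    then have "(\<lambda>\<omega>. \<lambda>i\<in>UNIV. X \<omega> i) \<in> measurable M (Pi\<^sub>M UNIV (\<lambda>_. borel))"
      by (intro measurable_restrict)
    then show ?thesis by (simp only: restrict_UNIV)
  qed
  ultimately have "(\<lambda>\<omega>. f (restrict (X \<omega>) I)) \<in> borel_measurable M"
    by (rule measurable_compose_rev)
  moreover have "restrict (X \<omega>) I = X \<omega>" if "\<omega> \<in> space M" for \<omega>
    using measurable_space[OF X that] by (auto simp: space_PiM PiE_restrict)
  ultimately show ?thesis by (simp cong: measurable_cong)
qed

section \<open>Trigonometric polynomials and uniform approximation on cubes\<close>

text \<open>The phase \<open>b\<close> makes cosines suffice: a sine is a shifted cosine, and a
  constant has frequency zero. Each summand is a bounded continuous function of one linear
  combination of the coordinates, which is what the central limit theorem can handle.\<close>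

inductive trig_polynomial :: "'i set \<Rightarrow> (('i \<Rightarrow> real) \<Rightarrow> real) \<Rightarrow> bool" for I where
  cos: "trig_polynomial I (\<lambda>x. c * cos ((\<Sum>i\<in>I. a i * x i) + b))"
| add: "trig_polynomial I p \<Longrightarrow> trig_polynomial I q \<Longrightarrow> trig_polynomial I (\<lambda>x. p x + q x)"

lemma trig_polynomial_const: "trig_polynomial I (\<lambda>_. c)"
  using trig_polynomial.cos[of I c "\<lambda>_. 0" 0] by simp

text \<open>The product of two cosines is half the sum of the cosines of the difference and of the
  sum of their arguments. This supplies the algebra required by Stone--Weierstrass.\<close>

lemma trig_polynomial_mult:
  assumes "trig_polynomial I p" "trig_polynomial I q"
  shows "trig_polynomial I (\<lambda>x. p x * q x)"
  using assms(1)
proof induction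
  case (cos c a b)
  show ?case using assms(2)
  proof induction
    case (cos c' a' b')
    have "c * cos ((\<Sum>i\<in>I. a i * x i) + b) * (c' * cos ((\<Sum>i\<in>I. a' i * x i) + b')) =
        c * c' / 2 * cos ((\<Sum>i\<in>I. (a i - a' i) * x i) + (b - b')) +
        c * c' / 2 * cos ((\<Sum>i\<in>I. (a i + a' i) * x i) + (b + b'))" for x
    proof -
      have "(\<Sum>i\<in>I. (a i - a' i) * x i) + (b - b') =
          ((\<Sum>i\<in>I. a i * x i) + b) - ((\<Sum>i\<in>I. a' i * x i) + b')"
        "(\<Sum>i\<in>I. (a i + a' i) * x i) + (b + b') =
          ((\<Sum>i\<in>I. a i * x i) + b) + ((\<Sum>i\<in>I. a' i * x i) + b')"
        by (simp_all add: algebra_simps sum.distrib sum_subtractf)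
      then show ?thesis
        by (simp only: cos_add cos_diff) (simp add: algebra_simps)
    qed
    then show ?case
      by (simp only:) (intro trig_polynomial.intros)
  next
    case (add p q)
    then show ?case by (simp only: ring_distribs) (rule trig_polynomial.add)
  qed
next
  case (add p q)
  then show ?case by (simp only: ring_distribs) (rule trig_polynomial.add)
qed

lemma trig_polynomial_bounded: "trig_polynomial I p \<Longrightarrow> \<exists>L. \<forall>x. \<bar>p x\<bar> \<le> L"
proof (induction rule: trig_polynomial.induct)
  case (cos c a b)
  then show ?case
    by (intro exI[of _ "\<bar>c\<bar>"]) (auto simp: abs_mult intro: mult_left_le abs_cos_le_one)
next
  case (add p q)
  then obtain L L' where "\<And>x. \<bar>p x\<bar> \<le> L" "\<And>x. \<bar>q x\<bar> \<le> L'" by blast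
  then show ?case by (intro exI[of _ "L + L'"] allI order_trans[OF abs_triangle_ineq] add_mono)
qed

lemma trig_polynomial_continuous:
  fixes p :: "('i::countable \<Rightarrow> real) \<Rightarrow> real"
  shows "trig_polynomial I p \<Longrightarrow> continuous_on UNIV p"
proof (induction rule: trig_polynomial.induct)
  case (cos c a b)
  have "continuous_on UNIV (\<lambda>x::'i::countable \<Rightarrow> real. (\<Sum>i\<in>I. a i * x i) + b)"
    by (intro continuous_intros continuous_on_product_coordinates)
  then show ?case
    by (intro continuous_on_mult continuous_on_const continuous_on_cos)
qed (rule continuous_on_add)

text \<open>A real polynomial is built from linear functions and constants by sums and products, and
  the class is closed under these. A linear function of one real variable is multiplication by its
  value at 1.\<close>

lemma trig_polynomial_compose:
  assumes "real_polynomial_function q" "trig_polynomial I p"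
  shows "trig_polynomial I (\<lambda>x. q (p x))"
  using assms(1)
proof induction
  case (linear f)
  have "f 1 * y = f y" for y
    using linear_cmul[OF bounded_linear.linear[OF linear], of y 1] by (simp add: mult.commute)
  then have "(\<lambda>x. f 1 * p x) = (\<lambda>x. f (p x))"
    by (intro ext)
  then show ?case
    using trig_polynomial_mult[OF trig_polynomial_const assms(2), of "f 1"] by metis
next
  case (mult f g)
  then show ?case by (intro trig_polynomial_mult)
qed (auto intro: trig_polynomial_const trig_polynomial.add)

text \<open>Stone--Weierstrass gives no control of the approximant off the cube; it is
  obtained by composing with a polynomial close to the truncation at level \<open>B\<close>.\<close>
lemma bounded_trig_approximation:
  fixes f :: "('i::countable \<Rightarrow> real) \<Rightarrow> real"
  assumes "finite I" and f: "continuous_on (PiE I (\<lambda>_. {-R..R})) f"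
    and B: "\<And>x. x \<in> PiE I (\<lambda>_. {-R..R}) \<Longrightarrow> \<bar>f x\<bar> \<le> B" "0 \<le> B" and "0 < \<epsilon>"
  obtains p where "trig_polynomial I p" "\<And>x. \<bar>p x\<bar> \<le> B + \<epsilon>"
    "\<And>x. x \<in> PiE I (\<lambda>_. {-R..R}) \<Longrightarrow> \<bar>f x - p x\<bar> \<le> \<epsilon>"
proof -
  let ?K = "PiE I (\<lambda>_. {-R..R})"
  \<comment> \<open>With singleton factors off \<open>I\<close>, the extensional cube becomes a
    product over all indices, so that Tychonoff's theorem yields compactness in the topology of the
    function type.\<close>
  have K: "?K = PiE UNIV (\<lambda>i. if i \<in> I then {-R..R} else {undefined})"
    by (auto simp: PiE_iff extensional_def split: if_splits)
  have compact: "compact ?K"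
  proof -
    have "compactin (product_topology (\<lambda>_. euclideanreal) UNIV) ?K"
      unfolding K compactin_PiE by auto
    then show ?thesis by (simp add: euclidean_product_topology)
  qed
  interpret function_ring_on "Collect (trig_polynomial I)" ?K
  proof
    show "\<exists>p\<in>Collect (trig_polynomial I). p x \<noteq> p y" if xy: "x \<in> ?K" "y \<in> ?K" "x \<noteq> y" for x y
    proof -
      obtain i where i: "i \<in> I" "x i \<noteq> y i"
        using PiE_ext[OF xy(1,2)] xy(3) by blast
      \<comment> \<open>Periodicity could make a cosine agree at two distinct points. Scaling by the
        distance of the i-th coordinates and shifting by \<open>y i\<close> moves the argument from
        0 at \<open>y\<close> to 1 or -1 at \<open>x\<close>, so the values are 1 and
        \<open>cos 1\<close>.\<close>
      define a where "a j = (if j = i then 1 / (\<bar>x i - y i\<bar>) else 0)" for j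
      define p where "p z = 1 * cos ((\<Sum>j\<in>I. a j * z j) + (- y i / \<bar>x i - y i\<bar>))" for z
      have lin: "(\<Sum>j\<in>I. a j * z j) = z i / \<bar>x i - y i\<bar>" for z
        using i \<open>finite I\<close> by (simp add: a_def if_distrib[of "\<lambda>u. u * _"] cong: if_cong)
      have "p y = 1" unfolding p_def lin by simp
      moreover have "p x = cos 1"
      proof -
        have "x i / \<bar>x i - y i\<bar> + - y i / \<bar>x i - y i\<bar> = (x i - y i) / \<bar>x i - y i\<bar>"
          by (simp add: diff_divide_distrib)
        also have "\<dots> = sgn (x i - y i)"
          by (simp add: sgn_real_def abs_if divide_simps)
        finally show ?thesis using i unfolding p_def lin by (simp add: sgn_real_def)
      qed
      moreover have "cos 1 < (1::real)"
        using cos_monotone_0_pi[of 0 1] pi_gt3 by simp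
      moreover have "trig_polynomial I p"
        unfolding p_def by (rule trig_polynomial.cos)
      ultimately show ?thesis by (intro bexI[of _ p]) auto
    qed
  qed (auto simp: compact intro: trig_polynomial_mult trig_polynomial_const trig_polynomial.add
        continuous_on_subset[OF trig_polynomial_continuous])
  obtain p0 where p0: "trig_polynomial I p0" "\<And>x. x \<in> ?K \<Longrightarrow> \<bar>f x - p0 x\<bar> < \<epsilon> / 2"
    using Stone_Weierstrass_basic[OF f, of "\<epsilon> / 2"] \<open>0 < \<epsilon>\<close> by auto
  obtain L where L: "\<And>x. \<bar>p0 x\<bar> \<le> L" using trig_polynomial_bounded[OF p0(1)] by blast
  \<comment> \<open>Truncation fixes the values of \<open>f\<close> on the cube and is 1-Lipschitz,
    so \<open>trunc (p0 x)\<close> is still within \<open>\<epsilon> / 2\<close> of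
    \<open>f x\<close> there. As \<open>L\<close> bounds \<open>p0\<close> everywhere,
    \<open>q\<close> is close to \<open>trunc\<close> at every value that \<open>p0\<close>
    takes.\<close>
  define trunc where "trunc y = max (-B) (min B y)" for y
  have "continuous_on {-L..L} trunc"
    unfolding trunc_def by (intro continuous_intros)
  then obtain q where q: "real_polynomial_function q" "\<And>y. y \<in> {-L..L} \<Longrightarrow> \<bar>trunc y - q y\<bar> < \<epsilon> / 2"
    using Stone_Weierstrass_real_polynomial_function[of "{-L..L}" trunc "\<epsilon> / 2"] \<open>0 < \<epsilon>\<close> by auto
  have qp: "\<bar>trunc (p0 x) - q (p0 x)\<bar> < \<epsilon> / 2" for x
    using q(2)[of "p0 x"] L[of x] by (auto simp: abs_le_iff)
  show thesis
  proof
    show "trig_polynomial I (\<lambda>x. q (p0 x))"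
      by (rule trig_polynomial_compose[OF q(1) p0(1)])
    show "\<bar>q (p0 x)\<bar> \<le> B + \<epsilon>" for x
      using qp[of x] \<open>0 < \<epsilon>\<close> \<open>0 \<le> B\<close> unfolding trunc_def by linarith
    show "\<bar>f x - q (p0 x)\<bar> \<le> \<epsilon>" if "x \<in> ?K" for x
      using qp[of x] p0(2)[OF that] B(1)[OF that] unfolding trunc_def by linarith
  qed
qed

section \<open>The Cramer--Wold device\<close>

text \<open>Expectations of trigonometric polynomials converge summand by summand. Replacing a
  bounded continuous \<open>f\<close> by such a polynomial costs the uniform error on a cube, plus
  the sum of the two bounds times the probability of leaving the cube. Tightness of the coordinates,
  which are linear combinations with unit-vector coefficients, controls that probability.\<close>

lemma cramer_wold:
  fixes X :: "nat \<Rightarrow> 'a \<Rightarrow> 'i::countable \<Rightarrow> real"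
  assumes "prob_space M" "prob_space N" "finite I"
    and X: "\<And>n. X n \<in> measurable M (\<Pi>\<^sub>M i\<in>I. borel)" and Y: "Y \<in> measurable N (\<Pi>\<^sub>M i\<in>I. borel)"
    and lim: "\<And>a (g :: real \<Rightarrow> real). continuous_on UNIV g \<Longrightarrow> bounded (range g) \<Longrightarrow>
        (\<lambda>n. \<integral>\<omega>. g (\<Sum>i\<in>I. a i * X n \<omega> i) \<partial>M) \<longlonglongrightarrow> (\<integral>\<omega>. g (\<Sum>i\<in>I. a i * Y \<omega> i) \<partial>N)"
  shows "converges_in_distribution I M X N Y"
  unfolding converges_in_distribution_def
proof (intro conjI allI impI X Y)
  interpret M: prob_space M by fact
  interpret N: prob_space N by fact
  have coord: "(\<Sum>j\<in>I. of_bool (j = i) * z j) = z i" if "i \<in> I" for i and z :: "'i \<Rightarrow> real"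
  proof -
    have "(\<Sum>j\<in>I. of_bool (j = i) * z j) = (\<Sum>j\<in>I. if j = i then z j else 0)"
      by (intro sum.cong) auto
    then show ?thesis using that \<open>finite I\<close> by simp
  qed
  have Xi: "(\<lambda>\<omega>. X n \<omega> i) \<in> borel_measurable M" if "i \<in> I" for n i
    by (rule measurable_compose[OF X measurable_component_singleton[OF that]])
  have Yi: "(\<lambda>\<omega>. Y \<omega> i) \<in> borel_measurable N" if "i \<in> I" for i
    by (rule measurable_compose[OF Y measurable_component_singleton[OF that]])
  have limi: "(\<lambda>n. \<integral>\<omega>. g (X n \<omega> i) \<partial>M) \<longlonglongrightarrow> (\<integral>\<omega>. g (Y \<omega> i) \<partial>N)"
    if "i \<in> I" "continuous_on UNIV g" "bounded (range g)" for i and g :: "real \<Rightarrow> real"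
    using lim[OF that(2,3), of "\<lambda>j. of_bool (j = i)"] that by (simp only: coord)
  have trig_meas: "(\<lambda>\<omega>. p (Z \<omega>)) \<in> borel_measurable Q"
    if "trig_polynomial I p" "\<And>i. i \<in> I \<Longrightarrow> (\<lambda>\<omega>. Z \<omega> i) \<in> borel_measurable Q"
    for p and Z :: "'c \<Rightarrow> 'i \<Rightarrow> real" and Q
    using that(1) by induction (use that(2) in \<open>measurable\<close>)
  have trig_X: "(\<lambda>\<omega>. p (X n \<omega>)) \<in> borel_measurable M" if "trig_polynomial I p" for p n
    by (rule trig_meas[OF that Xi])
  have trig_Y: "(\<lambda>\<omega>. p (Y \<omega>)) \<in> borel_measurable N" if "trig_polynomial I p" for p
    by (rule trig_meas[OF that Yi])
  have trig_lim: "(\<lambda>n. \<integral>\<omega>. p (X n \<omega>) \<partial>M) \<longlonglongrightarrow> (\<integral>\<omega>. p (Y \<omega>) \<partial>N)" if "trig_polynomial I p" for p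
    using that
  proof induction
    case (cos c a b)
    have cont: "continuous_on UNIV (\<lambda>y. c * cos (y + b))"
      by (intro continuous_intros)
    have bdd: "bounded (range (\<lambda>y. c * cos (y + b)))"
      by (rule boundedI[where B="\<bar>c\<bar>"]) (auto simp: abs_mult intro!: mult_left_le)
    show ?case
      using lim[OF cont bdd, of a] by simp
  next
    case (add p q)
    obtain L where L: "\<And>x. \<bar>p x\<bar> \<le> L"
      using trig_polynomial_bounded[OF add.hyps(1)] by blast
    obtain L' where L': "\<And>x. \<bar>q x\<bar> \<le> L'"
      using trig_polynomial_bounded[OF add.hyps(2)] by blast
    have "integrable M (\<lambda>\<omega>. p (X n \<omega>))" "integrable M (\<lambda>\<omega>. q (X n \<omega>))" for n
      using L L' trig_X add.hyps
      by (auto intro: M.integrable_const_bound[where B=L] M.integrable_const_bound[where B=L'])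
    moreover have "integrable N (\<lambda>\<omega>. p (Y \<omega>))" "integrable N (\<lambda>\<omega>. q (Y \<omega>))"
      using L L' trig_Y add.hyps
      by (auto intro: N.integrable_const_bound[where B=L] N.integrable_const_bound[where B=L'])
    ultimately show ?case
      using tendsto_add[OF add.IH] by simp
  qed
  fix f :: "('i \<Rightarrow> real) \<Rightarrow> real"
  assume f: "continuous_map (powertop_real I) euclideanreal f \<and> bounded (f ` topspace (powertop_real I))"
  then obtain B where "0 < B" and B: "\<And>x. x \<in> extensional I \<Longrightarrow> \<bar>f x\<bar> \<le> B"
    by (auto simp: bounded_pos PiE_UNIV_domain PiE_def)
  show "(\<lambda>n. \<integral>\<omega>. f (X n \<omega>) \<partial>M) \<longlonglongrightarrow> (\<integral>\<omega>. f (Y \<omega>) \<partial>N)"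
  proof (rule LIMSEQ_I)
    fix r :: real assume "0 < r"
    \<comment> \<open>The total error is \<open>e\<close> for the polynomial plus twice
      \<open>e + (2 * B + 1) * e\<close> for the two replacements, that is
      \<open>e * (5 + 4 * B)\<close>. The minimum with 1 ensures
      \<open>B + (B + e) \<le> 2 * B + 1\<close>.\<close>
    define e where "e = min 1 (r / (5 + 4 * B))"
    have "e \<le> r / (5 + 4 * B)" by (simp add: e_def)
    then have e: "0 < e" "e \<le> 1" "e * (5 + 4 * B) \<le> r"
      using \<open>0 < r\<close> \<open>0 < B\<close> by (simp_all add: pos_le_divide_eq) (simp_all add: e_def)
    have "\<exists>R. \<forall>\<^sub>F n in sequentially. M.prob {\<omega> \<in> space M. \<exists>i\<in>I. R < \<bar>X n \<omega> i\<bar>} < e"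
    proof (rule tight_of_coordinatewise_limit)
      show "(\<lambda>n. \<integral>\<omega>. g (X n \<omega> i) \<partial>M) \<longlonglongrightarrow> (\<integral>\<omega>. g (Y \<omega> i) \<partial>N)"
        if "i \<in> I" "continuous_on UNIV g" "bounded (range g)" for i and g :: "real \<Rightarrow> real"
        using that by (rule limi)
    qed (fact | erule Xi Yi)+
    then obtain R1 where R1: "\<forall>\<^sub>F n in sequentially. M.prob {\<omega> \<in> space M. \<exists>i\<in>I. R1 < \<bar>X n \<omega> i\<bar>} < e"
      by blast
    \<comment> \<open>The constant sequence \<open>Y\<close> converges to itself, so the same
      tightness result bounds the tail of the limit.\<close>
    have "\<exists>R. \<forall>\<^sub>F n::nat in sequentially. N.prob {\<omega> \<in> space N. \<exists>i\<in>I. R < \<bar>Y \<omega> i\<bar>} < e"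
      by (rule tight_of_coordinatewise_limit[where X="\<lambda>_. Y" and Y=Y and N=N])
        (fact | erule Yi | rule tendsto_const)+
    then obtain R2 where R2: "N.prob {\<omega> \<in> space N. \<exists>i\<in>I. R2 < \<bar>Y \<omega> i\<bar>} < e"
      by (auto simp: eventually_const)
    define R where "R = max R1 R2"
    let ?K = "PiE I (\<lambda>_. {-R..R})"
    \<comment> \<open>\<open>f\<close> is known to be continuous only on extensional functions; on
      the cube \<open>restrict\<close> is the identity, so nothing is lost.\<close>
    have "continuous_on ?K (\<lambda>x. f (restrict x I))"
      using continuous_on_powertop f by (blast intro: continuous_on_subset)
    then have fK: "continuous_on ?K f"
      by (rule continuous_on_eq) (auto simp: PiE_restrict)
    obtain p where p: "trig_polynomial I p" "\<And>x. \<bar>p x\<bar> \<le> B + e" "\<And>x. x \<in> ?K \<Longrightarrow> \<bar>f x - p x\<bar> \<le> e"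
      using bounded_trig_approximation[OF \<open>finite I\<close> fK _ less_imp_le[OF \<open>0 < B\<close>] e(1)] B
      by (metis PiE_iff)
    \<comment> \<open>The probability space is left generic, also in its type, since the estimate is
      needed for \<open>X n\<close> on \<open>M\<close> and for \<open>Y\<close> on
      \<open>N\<close>. Each comes with its own tail threshold \<open>R'\<close>, and passing to the
      larger \<open>R\<close> only shrinks the tail event.\<close>
    have approx: "\<bar>(\<integral>\<omega>. f (Z \<omega>) \<partial>Q) - (\<integral>\<omega>. p (Z \<omega>) \<partial>Q)\<bar> \<le> e + (2 * B + 1) * e"
      if "prob_space Q" and Z: "Z \<in> measurable Q (\<Pi>\<^sub>M i\<in>I. borel)"
        and tail: "measure Q {\<omega> \<in> space Q. \<exists>i\<in>I. R' < \<bar>Z \<omega> i\<bar>} < e" and "R' \<le> R"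
      for Q :: "'q measure" and Z R'
    proof -
      interpret Q: prob_space Q by fact
      let ?A = "\<lambda>R. {\<omega> \<in> space Q. \<exists>i\<in>I. R < \<bar>Z \<omega> i\<bar>}"
      have Zi: "(\<lambda>\<omega>. Z \<omega> i) \<in> borel_measurable Q" if "i \<in> I" for i
        by (rule measurable_compose[OF Z measurable_component_singleton[OF that]])
      have A: "?A R \<in> sets Q" for R
      proof -
        have "{\<omega> \<in> space Q. R < \<bar>Z \<omega> i\<bar>} \<in> sets Q" if "i \<in> I" for i
        proof -
          note Zi[OF that, measurable]
          show ?thesis by measurable
        qed
        then have "(\<Union>i\<in>I. {\<omega> \<in> space Q. R < \<bar>Z \<omega> i\<bar>}) \<in> sets Q"
          using \<open>finite I\<close> by (intro sets.finite_UN)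
        also have "(\<Union>i\<in>I. {\<omega> \<in> space Q. R < \<bar>Z \<omega> i\<bar>}) = ?A R" by blast
        finally show ?thesis .
      qed
      have ext: "Z \<omega> \<in> extensional I" if "\<omega> \<in> space Q" for \<omega>
        using measurable_space[OF Z that] by (simp add: space_PiM PiE_def)
      have "Q.prob (?A R) \<le> Q.prob (?A R')"
        using \<open>R' \<le> R\<close> by (intro Q.finite_measure_mono A) (blast intro: le_less_trans)
      then have A_le: "Q.prob (?A R) \<le> e" using tail by linarith
      have "\<bar>(\<integral>\<omega>. f (Z \<omega>) \<partial>Q) - (\<integral>\<omega>. p (Z \<omega>) \<partial>Q)\<bar> \<le> e + (B + (B + e)) * Q.prob (?A R)"
      proof (rule Q.integral_diff_le)
        show "(\<lambda>\<omega>. f (Z \<omega>)) \<in> borel_measurable Q"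
          using f by (intro measurable_continuous_powertop[OF _ Z]) blast
        show "(\<lambda>\<omega>. p (Z \<omega>)) \<in> borel_measurable Q"
          by (rule trig_meas[OF p(1) Zi])
        show "\<bar>f (Z \<omega>) - p (Z \<omega>)\<bar> \<le> e" if "\<omega> \<in> space Q" "\<omega> \<notin> ?A R" for \<omega>
        proof (rule p(3))
          have "\<bar>Z \<omega> i\<bar> \<le> R" if "i \<in> I" for i
            using that \<open>\<omega> \<notin> ?A R\<close> \<open>\<omega> \<in> space Q\<close> by (blast intro: leI)
          then have "Z \<omega> i \<in> {-R..R}" if "i \<in> I" for i
            using that by (simp add: abs_le_iff minus_le_iff)
          then show "Z \<omega> \<in> ?K" using ext[OF that(1)] by (simp add: PiE_iff)
        qed
      qed (fact A | rule p(2) | erule B[OF ext] | rule less_imp_le[OF e(1)])+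
      also have "\<dots> \<le> e + (2 * B + 1) * e"
        using A_le e \<open>0 < B\<close> by (intro add_left_mono mult_mono) auto
      finally show ?thesis .
    qed
    have "\<forall>\<^sub>F n in sequentially. \<bar>(\<integral>\<omega>. p (X n \<omega>) \<partial>M) - (\<integral>\<omega>. p (Y \<omega>) \<partial>N)\<bar> < e"
      using tendstoD[OF trig_lim[OF p(1)] e(1)] by (simp add: dist_real_def)
    with R1 have "\<forall>\<^sub>F n in sequentially. \<bar>(\<integral>\<omega>. f (X n \<omega>) \<partial>M) - (\<integral>\<omega>. f (Y \<omega>) \<partial>N)\<bar> < r"
    proof eventually_elim
      case (elim n)
      have 1: "\<bar>(\<integral>\<omega>. f (X n \<omega>) \<partial>M) - (\<integral>\<omega>. p (X n \<omega>) \<partial>M)\<bar> \<le> e + (2 * B + 1) * e"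
        using elim by (intro approx[OF \<open>prob_space M\<close> X, of R1]) (auto simp: R_def)
      have 2: "\<bar>(\<integral>\<omega>. f (Y \<omega>) \<partial>N) - (\<integral>\<omega>. p (Y \<omega>) \<partial>N)\<bar> \<le> e + (2 * B + 1) * e"
        using R2 by (intro approx[OF \<open>prob_space N\<close> Y, of R2]) (auto simp: R_def)
      have "e + 2 * (e + (2 * B + 1) * e) = e * (5 + 4 * B)" by (simp add: algebra_simps)
      then have "e + 2 * (e + (2 * B + 1) * e) \<le> r" using e(3) by linarith
      moreover have "\<bar>a - c\<bar> < r" if "\<bar>a - b\<bar> \<le> s" "\<bar>c - d\<bar> \<le> s" "\<bar>b - d\<bar> < e" "e + 2 * s \<le> r" for a b c d s
        using that by linarith
      ultimately show ?case using 1 2 elim(2) by blast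
    qed
    then show "\<exists>n0. \<forall>n\<ge>n0. norm ((\<integral>\<omega>. f (X n \<omega>) \<partial>M) - (\<integral>\<omega>. f (Y \<omega>) \<partial>N)) < r"
      by (simp add: eventually_sequentially)
  qed
qed

section \<open>A mapping theorem with varying maps\<close>

text \<open>Each coordinate is a continuous real function of \<open>X\<close>, and continuity into
  \<open>powertop_real J\<close> forces extensional values, so reassembling the coordinates with
  \<open>restrict\<close> changes nothing.\<close>

lemma measurable_powertop_map:
  fixes \<phi> :: "('i::countable \<Rightarrow> real) \<Rightarrow> 'j \<Rightarrow> real"
  assumes \<phi>: "continuous_map (powertop_real I) (powertop_real J) \<phi>"
    and X: "X \<in> measurable M (\<Pi>\<^sub>M i\<in>I. borel)"
  shows "(\<lambda>\<omega>. \<phi> (X \<omega>)) \<in> measurable M (\<Pi>\<^sub>M j\<in>J. borel)"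
proof -
  have cont: "continuous_map (powertop_real I) euclideanreal (\<lambda>x. \<phi> x j)" if "j \<in> J" for j
    using \<phi> that by (simp add: continuous_map_componentwise)
  have "(\<lambda>\<omega>. \<lambda>j\<in>J. \<phi> (X \<omega>) j) \<in> measurable M (\<Pi>\<^sub>M j\<in>J. borel)"
    by (intro measurable_restrict measurable_continuous_powertop[OF cont X])
  moreover have "(\<lambda>j\<in>J. \<phi> (X \<omega>) j) = \<phi> (X \<omega>)" if "\<omega> \<in> space M" for \<omega>
  proof -
    have "X \<omega> \<in> topspace (powertop_real I)"
      using measurable_space[OF X that] by (simp add: space_PiM)
    then have "\<phi> (X \<omega>) \<in> extensional J"
      using \<phi> by (auto simp: continuous_map_componentwise)
    then show ?thesis by (rule extensional_restrict)
  qed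
  ultimately show ?thesis by (simp cong: measurable_cong)
qed

text \<open>The fixed map \<open>\<psi>\<close> is covered by testing \<open>X n\<close> against
  \<open>f\<close> composed with \<open>\<psi>\<close>, which is bounded and continuous. Replacing
  \<open>\<phi> n\<close> by \<open>\<psi>\<close> changes nothing on a cube for large
  \<open>n\<close>, and tightness makes the rest negligible. Agreement must hold for all points of a
  cube from one \<open>n\<close> on, but need not be uniform in the size of the cube.\<close>

lemma converges_in_distribution_map:
  fixes X :: "nat \<Rightarrow> 'a \<Rightarrow> 'i::countable \<Rightarrow> real" and \<phi> :: "nat \<Rightarrow> ('i \<Rightarrow> real) \<Rightarrow> 'j::countable \<Rightarrow> real"
  assumes "prob_space M" "prob_space N" "finite I"
    and conv: "converges_in_distribution I M X N Y"
    and \<phi>: "\<And>n. continuous_map (powertop_real I) (powertop_real J) (\<phi> n)"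
    and \<psi>: "continuous_map (powertop_real I) (powertop_real J) \<psi>"
    and eq: "\<And>R. \<forall>\<^sub>F n in sequentially. \<forall>x \<in> PiE I (\<lambda>_. {-R..R}). \<phi> n x = \<psi> x"
  shows "converges_in_distribution J M (\<lambda>n \<omega>. \<phi> n (X n \<omega>)) N (\<lambda>\<omega>. \<psi> (Y \<omega>))"
proof -
  interpret M: prob_space M by fact
  interpret N: prob_space N by fact
  have X: "X n \<in> measurable M (\<Pi>\<^sub>M i\<in>I. borel)" for n
    using conv by (simp add: converges_in_distribution_def)
  have Y: "Y \<in> measurable N (\<Pi>\<^sub>M i\<in>I. borel)"
    using conv by (simp add: converges_in_distribution_def)
  have lim: "(\<lambda>n. \<integral>\<omega>. f (X n \<omega>) \<partial>M) \<longlonglongrightarrow> (\<integral>\<omega>. f (Y \<omega>) \<partial>N)"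
    if "continuous_map (powertop_real I) euclideanreal f" "bounded (f ` topspace (powertop_real I))" for f
    using conv that by (simp add: converges_in_distribution_def)
  have Xi: "(\<lambda>\<omega>. X n \<omega> i) \<in> borel_measurable M" if "i \<in> I" for n i
    by (rule measurable_compose[OF X measurable_component_singleton[OF that]])
  have Yi: "(\<lambda>\<omega>. Y \<omega> i) \<in> borel_measurable N" if "i \<in> I" for i
    by (rule measurable_compose[OF Y measurable_component_singleton[OF that]])
  have XI: "X n \<omega> \<in> extensional I" if "\<omega> \<in> space M" for n \<omega>
    using measurable_space[OF X that] by (simp add: space_PiM PiE_def)
  have tight: "\<exists>R. \<forall>\<^sub>F n in sequentially. M.prob {\<omega> \<in> space M. \<exists>i\<in>I. R < \<bar>X n \<omega> i\<bar>} < e" if "0 < e" for e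
  proof (rule tight_of_coordinatewise_limit)
    fix i and g :: "real \<Rightarrow> real"
    assume i: "i \<in> I" and g: "continuous_on UNIV g" "bounded (range g)"
    have "continuous_map (powertop_real I) euclideanreal (\<lambda>x. g (x i))"
      using continuous_map_compose[OF continuous_map_product_projection[OF i, of "\<lambda>_. euclideanreal"], of euclideanreal g] g(1)
      by (simp add: o_def)
    moreover have "bounded ((\<lambda>x. g (x i)) ` topspace (powertop_real I))"
      by (rule bounded_subset[OF g(2)]) auto
    ultimately show "(\<lambda>n. \<integral>\<omega>. g (X n \<omega> i) \<partial>M) \<longlonglongrightarrow> (\<integral>\<omega>. g (Y \<omega> i) \<partial>N)"
      by (rule lim)
  qed (fact | erule Xi Yi)+
  show ?thesis
    unfolding converges_in_distribution_def
  proof (intro conjI allI impI)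
    show "(\<lambda>\<omega>. \<phi> n (X n \<omega>)) \<in> measurable M (\<Pi>\<^sub>M j\<in>J. borel)" for n
      by (rule measurable_powertop_map[OF \<phi> X])
    show "(\<lambda>\<omega>. \<psi> (Y \<omega>)) \<in> measurable N (\<Pi>\<^sub>M j\<in>J. borel)"
      by (rule measurable_powertop_map[OF \<psi> Y])
    fix f :: "('j \<Rightarrow> real) \<Rightarrow> real"
    assume "continuous_map (powertop_real J) euclideanreal f \<and> bounded (f ` topspace (powertop_real J))"
    then have f: "continuous_map (powertop_real J) euclideanreal f"
      and bdd: "bounded (f ` topspace (powertop_real J))" by auto
    from bdd obtain B where "0 < B" and B: "\<And>x. x \<in> topspace (powertop_real J) \<Longrightarrow> \<bar>f x\<bar> \<le> B"
      unfolding bounded_pos real_norm_def by blast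
    have into: "\<theta> x \<in> topspace (powertop_real J)"
      if "x \<in> topspace (powertop_real I)" "continuous_map (powertop_real I) (powertop_real J) \<theta>" for x and \<theta> :: "('i \<Rightarrow> real) \<Rightarrow> 'j \<Rightarrow> real"
      using that(1) continuous_map_image_subset_topspace[OF that(2)] by blast
    have Xtop: "X n \<omega> \<in> topspace (powertop_real I)" if "\<omega> \<in> space M" for n \<omega>
      using measurable_space[OF X that] by (simp add: space_PiM)
    have cont: "continuous_map (powertop_real I) euclideanreal (\<lambda>x. f (\<theta> x))"
      if "continuous_map (powertop_real I) (powertop_real J) \<theta>" for \<theta>
      using continuous_map_compose[OF that f] by (simp add: o_def)
    have "bounded ((\<lambda>x. f (\<psi> x)) ` topspace (powertop_real I))"
      by (rule bounded_subset[OF bdd]) (use into[OF _ \<psi>] in blast)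
    then have limit: "(\<lambda>n. \<integral>\<omega>. f (\<psi> (X n \<omega>)) \<partial>M) \<longlonglongrightarrow> (\<integral>\<omega>. f (\<psi> (Y \<omega>)) \<partial>N)"
      by (rule lim[OF cont[OF \<psi>]])
    have "(\<lambda>n. (\<integral>\<omega>. f (\<phi> n (X n \<omega>)) \<partial>M) - (\<integral>\<omega>. f (\<psi> (X n \<omega>)) \<partial>M)) \<longlonglongrightarrow> 0"
    proof (rule tendstoI)
      fix r :: real assume "0 < r"
      \<comment> \<open>On the tail event both integrands are bounded by \<open>B\<close>, so the
        difference costs at most \<open>B + B\<close> times its probability.\<close>
      define e where "e = r / (B + B)"
      have "0 < e" using \<open>0 < r\<close> \<open>0 < B\<close> by (simp add: e_def)
      obtain R where R: "\<forall>\<^sub>F n in sequentially. M.prob {\<omega> \<in> space M. \<exists>i\<in>I. R < \<bar>X n \<omega> i\<bar>} < e"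
        using tight[OF \<open>0 < e\<close>] by blast
      from R eq[of R] show "\<forall>\<^sub>F n in sequentially.
          dist ((\<integral>\<omega>. f (\<phi> n (X n \<omega>)) \<partial>M) - (\<integral>\<omega>. f (\<psi> (X n \<omega>)) \<partial>M)) 0 < r"
      proof eventually_elim
        case (elim n)
        let ?A = "{\<omega> \<in> space M. \<exists>i\<in>I. R < \<bar>X n \<omega> i\<bar>}"
        have "{\<omega> \<in> space M. R < \<bar>X n \<omega> i\<bar>} \<in> sets M" if "i \<in> I" for i
        proof -
          note Xi[OF that, measurable]
          show ?thesis by measurable
        qed
        then have "(\<Union>i\<in>I. {\<omega> \<in> space M. R < \<bar>X n \<omega> i\<bar>}) \<in> sets M"
          using \<open>finite I\<close> by (intro sets.finite_UN)
        also have "(\<Union>i\<in>I. {\<omega> \<in> space M. R < \<bar>X n \<omega> i\<bar>}) = ?A" by blast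
        finally have A: "?A \<in> sets M" .
        have same: "\<phi> n (X n \<omega>) = \<psi> (X n \<omega>)" if "\<omega> \<in> space M" "\<omega> \<notin> ?A" for \<omega>
        proof -
          have "\<bar>X n \<omega> i\<bar> \<le> R" if "i \<in> I" for i
            using that \<open>\<omega> \<notin> ?A\<close> \<open>\<omega> \<in> space M\<close> by (blast intro: leI)
          then have "X n \<omega> i \<in> {-R..R}" if "i \<in> I" for i
            using that by (simp add: abs_le_iff minus_le_iff)
          then have "X n \<omega> \<in> PiE I (\<lambda>_. {-R..R})" using XI[OF that(1)] by (simp add: PiE_iff)
          then show ?thesis using elim(2) by blast
        qed
        have "\<bar>(\<integral>\<omega>. f (\<phi> n (X n \<omega>)) \<partial>M) - (\<integral>\<omega>. f (\<psi> (X n \<omega>)) \<partial>M)\<bar> \<le> 0 + (B + B) * M.prob ?A"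
        proof (rule M.integral_diff_le)
          show "(\<lambda>\<omega>. f (\<phi> n (X n \<omega>))) \<in> borel_measurable M"
            by (rule measurable_continuous_powertop[OF cont[OF \<phi>] X])
          show "(\<lambda>\<omega>. f (\<psi> (X n \<omega>))) \<in> borel_measurable M"
            by (rule measurable_continuous_powertop[OF cont[OF \<psi>] X])
          show "\<bar>f (\<phi> n (X n \<omega>)) - f (\<psi> (X n \<omega>))\<bar> \<le> 0" if "\<omega> \<in> space M" "\<omega> \<notin> ?A" for \<omega>
            using same[OF that] by simp
          show "\<bar>f (\<phi> n (X n \<omega>))\<bar> \<le> B" "\<bar>f (\<psi> (X n \<omega>))\<bar> \<le> B" if "\<omega> \<in> space M" for \<omega>
            by (rule B[OF into[OF Xtop[OF that] \<phi>]] B[OF into[OF Xtop[OF that] \<psi>]])+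
        qed (use A in simp_all)
        also have "\<dots> < (B + B) * e"
          using elim(1) \<open>0 < B\<close> by simp
        also have "\<dots> = r" using \<open>0 < B\<close> by (simp add: e_def)
        finally show ?case by (simp add: dist_real_def)
      qed
    qed
    from tendsto_add[OF this limit] show "(\<lambda>n. \<integral>\<omega>. f (\<phi> n (X n \<omega>)) \<partial>M) \<longlonglongrightarrow> (\<integral>\<omega>. f (\<psi> (Y \<omega>)) \<partial>N)"
      by simp
  qed
qed

section \<open>The max-min formula: affine changes, localization, continuity\<close>

lemma max_min_avg_cong:
  assumes "a \<le> i" "i \<le> b" "\<And>j. j \<in> {a..b} \<Longrightarrow> x j = y j"
  shows "max_min_avg a b x i = max_min_avg a b y i"
proof -
  have "(\<Sum>j=r..s. x j) = (\<Sum>j=r..s. y j)" if "r \<in> {a..i}" "s \<in> {i..b}" for r s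
    using that assms by (intro sum.cong) auto
  then show ?thesis
    unfolding max_min_avg_def by (intro arg_cong[where f=Max] image_cong arg_cong[where f=Min]) auto
qed

text \<open>For nonnegative \<open>c\<close> the map \<open>?f\<close> is nondecreasing, hence
  commutes with maxima and minima, and being affine it commutes with averages. The case
  \<open>c = 0\<close> is included, as the factor \<open>sqrt n\<close> vanishes at
  \<open>n = 0\<close>.\<close>

lemma max_min_avg_affine:
  assumes "a \<le> i" "i \<le> b" "0 \<le> c"
  shows "c * (max_min_avg a b x i - d) = max_min_avg a b (\<lambda>j. c * (x j - d)) i"
proof -
  let ?f = "\<lambda>u. c * (u - d)"
  have mono: "mono ?f"
    using \<open>0 \<le> c\<close> by (intro monoI mult_left_mono) auto
  have avg: "?f ((\<Sum>j=r..s. x j) / (real s - real r + 1)) = (\<Sum>j=r..s. ?f (x j)) / (real s - real r + 1)"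
    if "r \<in> {a..i}" "s \<in> {i..b}" for r s
  proof -
    have "r \<le> s" using that by auto
    then have "(\<Sum>j=r..s. ?f (x j)) = c * ((\<Sum>j=r..s. x j) - (real s - real r + 1) * d)"
      by (simp add: sum_distrib_left[symmetric] sum_subtractf of_nat_diff Suc_diff_le)
    moreover have "real s - real r + 1 \<noteq> 0" using \<open>r \<le> s\<close> by linarith
    ultimately show ?thesis by (simp add: field_simps)
  qed
  have "?f (max_min_avg a b x i) = (MAX r\<in>{a..i}. ?f (MIN s\<in>{i..b}. (\<Sum>j=r..s. x j) / (real s - real r + 1)))"
    unfolding max_min_avg_def using assms by (subst mono_Max_commute[OF mono]) (auto simp: image_image)
  also have "\<dots> = (MAX r\<in>{a..i}. MIN s\<in>{i..b}. ?f ((\<Sum>j=r..s. x j) / (real s - real r + 1)))"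
    using assms by (subst mono_Min_commute[OF mono]) (auto simp: image_image)
  also have "\<dots> = max_min_avg a b (\<lambda>j. c * (x j - d)) i"
    unfolding max_min_avg_def using avg
    by (intro arg_cong[where f=Max] image_cong arg_cong[where f=Min]) auto
  finally show ?thesis .
qed

text \<open>The old average is at most \<open>R\<close>, while the appended entries average at least
  \<open>R\<close>, so appending cannot lower the average. After clearing denominators, with
  \<open>p\<close> old and \<open>q\<close> appended entries, this compares both sides with
  \<open>p * q * R\<close>.\<close>

lemma average_le_extend_right:
  fixes v :: "nat \<Rightarrow> real"
  assumes "r \<le> b" "b \<le> s" and lo: "\<And>j. j \<in> {r..b} \<Longrightarrow> v j \<le> R" and hi: "\<And>j. j \<in> {b<..s} \<Longrightarrow> R \<le> v j"
  shows "(\<Sum>j=r..b. v j) / (real b - real r + 1) \<le> (\<Sum>j=r..s. v j) / (real s - real r + 1)"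
proof -
  define p q where "p = real b - real r + 1" and "q = real s - real b"
  have p: "0 < p" and q: "0 \<le> q" using assms(1,2) by (auto simp: p_def q_def)
  have "{r..s} = {r..b} \<union> {b<..s}" using assms(1,2) by auto
  then have split: "(\<Sum>j=r..s. v j) = (\<Sum>j=r..b. v j) + (\<Sum>j\<in>{b<..s}. v j)"
    by (simp only:, intro sum.union_disjoint) auto
  have "(\<Sum>j=r..b. v j) \<le> of_nat (card {r..b}) * R"
    by (rule sum_bounded_above[OF lo])
  then have L: "(\<Sum>j=r..b. v j) \<le> p * R"
    using assms(1) by (simp add: p_def of_nat_diff Suc_diff_le add.commute)
  have "of_nat (card {b<..s}) * R \<le> (\<Sum>j\<in>{b<..s}. v j)"
    by (rule sum_bounded_below[OF hi])
  then have H: "q * R \<le> (\<Sum>j\<in>{b<..s}. v j)"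
    using assms(2) by (simp add: q_def of_nat_diff)
  have "(\<Sum>j=r..b. v j) * q \<le> p * R * q" using L q by (rule mult_right_mono)
  also have "\<dots> \<le> p * (\<Sum>j\<in>{b<..s}. v j)"
    using mult_left_mono[OF H less_imp_le[OF p]] by (simp add: ac_simps)
  finally have "(\<Sum>j=r..b. v j) * (p + q) \<le> (\<Sum>j=r..s. v j) * p"
    unfolding split by (simp add: algebra_simps)
  moreover have "real s - real r + 1 = p + q" by (simp add: p_def q_def)
  ultimately show ?thesis
    using p q unfolding p_def[symmetric] by (simp add: frac_le_eq divide_simps)
qed

text \<open>The mirror image: here \<open>q\<close> entries, each at most \<open>R\<close>, are put
  in front of \<open>p\<close> entries that are at least \<open>R\<close>, which cannot raise the
  average.\<close>

lemma average_extend_left_le: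
  fixes v :: "nat \<Rightarrow> real"
  assumes "r \<le> a" "a \<le> s" and lo: "\<And>j. j \<in> {r..<a} \<Longrightarrow> v j \<le> R" and hi: "\<And>j. j \<in> {a..s} \<Longrightarrow> R \<le> v j"
  shows "(\<Sum>j=r..s. v j) / (real s - real r + 1) \<le> (\<Sum>j=a..s. v j) / (real s - real a + 1)"
proof -
  define p q where "p = real s - real a + 1" and "q = real a - real r"
  have p: "0 < p" and q: "0 \<le> q" using assms(1,2) by (auto simp: p_def q_def)
  have "{r..s} = {r..<a} \<union> {a..s}" using assms(1,2) by auto
  then have split: "(\<Sum>j=r..s. v j) = (\<Sum>j\<in>{r..<a}. v j) + (\<Sum>j=a..s. v j)"
    by (simp only:, intro sum.union_disjoint) auto
  have "(\<Sum>j\<in>{r..<a}. v j) \<le> of_nat (card {r..<a}) * R"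
    by (rule sum_bounded_above[OF lo])
  then have L: "(\<Sum>j\<in>{r..<a}. v j) \<le> q * R"
    using assms(1) by (simp add: q_def of_nat_diff)
  have "of_nat (card {a..s}) * R \<le> (\<Sum>j=a..s. v j)"
    by (rule sum_bounded_below[OF hi])
  then have H: "p * R \<le> (\<Sum>j=a..s. v j)"
    using assms(2) by (simp add: p_def of_nat_diff Suc_diff_le add.commute)
  have "(\<Sum>j\<in>{r..<a}. v j) * p \<le> q * R * p" using L less_imp_le[OF p] by (rule mult_right_mono)
  also have "\<dots> \<le> q * (\<Sum>j=a..s. v j)"
    using mult_left_mono[OF H q] by (simp add: ac_simps)
  finally have "(\<Sum>j=r..s. v j) * p \<le> (\<Sum>j=a..s. v j) * (p + q)"
    unfolding split by (simp add: algebra_simps)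
  moreover have "real s - real r + 1 = p + q" by (simp add: p_def q_def)
  ultimately show ?thesis
    using p q unfolding p_def[symmetric] by (simp add: divide_simps)
qed

text \<open>A left end \<open>r\<close> below the block is beaten by \<open>a\<close>, and a right
  end \<open>s\<close> above it by \<open>b\<close>. The two replacements do not interfere: the
  former is needed only for \<open>s \<le> b\<close>, the latter only for \<open>r \<ge> a\<close>,
  so no comparison involves averages reaching out of the block on both sides.\<close>

lemma max_min_avg_localize:
  assumes "a' \<le> a" "a \<le> i" "i \<le> b" "b \<le> b'"
    and mid: "\<And>j. j \<in> {a..b} \<Longrightarrow> \<bar>v j\<bar> \<le> R"
    and lo: "\<And>j. j \<in> {a'..<a} \<Longrightarrow> v j \<le> - R" and hi: "\<And>j. j \<in> {b<..b'} \<Longrightarrow> R \<le> v j"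
  shows "max_min_avg a' b' v i = max_min_avg a b v i"
proof -
  define A where "A r s = (\<Sum>j=r..s. v j) / (real s - real r + 1)" for r s
  have right: "A r b \<le> A r s" if "r \<in> {a..i}" "s \<in> {b<..b'}" for r s
    unfolding A_def using that assms(2,3)
    by (intro average_le_extend_right[where R=R] hi) (auto dest!: abs_le_D1 intro: mid[THEN abs_le_D1])
  have left: "A r s \<le> A a s" if "r \<in> {a'..<a}" "s \<in> {i..b}" for r s
    unfolding A_def
  proof (rule average_extend_left_le[where R="- R"])
    show "- R \<le> v j" if "j \<in> {a..s}" for j
      using mid[of j] that \<open>s \<in> {i..b}\<close> by (auto simp: abs_le_iff)
  qed (use that assms(1,2) lo in auto)
  have ne: "{i..b} \<noteq> {}" "{i..b'} \<noteq> {}" "{a..i} \<noteq> {}" "{a'..i} \<noteq> {}" using assms(1-4) by auto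
  have "(MAX r\<in>{a'..i}. MIN s\<in>{i..b'}. A r s) = (MAX r\<in>{a..i}. MIN s\<in>{i..b}. A r s)"
  proof (rule antisym)
    show "(MAX r\<in>{a'..i}. MIN s\<in>{i..b'}. A r s) \<le> (MAX r\<in>{a..i}. MIN s\<in>{i..b}. A r s)"
    proof (rule Max.boundedI)
      fix u assume "u \<in> (\<lambda>r. MIN s\<in>{i..b'}. A r s) ` {a'..i}"
      then obtain r where r: "r \<in> {a'..i}" and u: "u = (MIN s\<in>{i..b'}. A r s)" by blast
      \<comment> \<open>Dropping the right ends beyond \<open>b\<close> can only raise the minimum,
        and moving the left end up to \<open>a\<close> can only raise each remaining
        average.\<close>
      have "u \<le> (MIN s\<in>{i..b}. A (max r a) s)"
      proof (rule Min.boundedI)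
        fix w assume "w \<in> A (max r a) ` {i..b}"
        then obtain s where s: "s \<in> {i..b}" and w: "w = A (max r a) s" by blast
        have "u \<le> A r s"
          unfolding u using s \<open>b \<le> b'\<close> by (intro Min_le) auto
        also have "\<dots> \<le> A (max r a) s"
          using left[of r s] r s by (cases "r < a") auto
        finally show "u \<le> w" using w by simp
      qed (use ne in auto)
      also have "\<dots> \<le> (MAX r\<in>{a..i}. MIN s\<in>{i..b}. A r s)"
        using r \<open>a \<le> i\<close> by (intro Max_ge) auto
      finally show "u \<le> (MAX r\<in>{a..i}. MIN s\<in>{i..b}. A r s)" .
    qed (use ne in auto)
    show "(MAX r\<in>{a..i}. MIN s\<in>{i..b}. A r s) \<le> (MAX r\<in>{a'..i}. MIN s\<in>{i..b'}. A r s)"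
    proof (rule Max.boundedI)
      fix u assume "u \<in> (\<lambda>r. MIN s\<in>{i..b}. A r s) ` {a..i}"
      then obtain r where r: "r \<in> {a..i}" and u: "u = (MIN s\<in>{i..b}. A r s)" by blast
      \<comment> \<open>Conversely, the additional right ends do not lower the minimum, since their
        averages are at least the one ending at \<open>b\<close>.\<close>
      have "u \<le> (MIN s\<in>{i..b'}. A r s)"
      proof (rule Min.boundedI)
        fix w assume "w \<in> A r ` {i..b'}"
        then obtain s where s: "s \<in> {i..b'}" and w: "w = A r s" by blast
        have "u \<le> A r (min s b)"
          unfolding u using s \<open>i \<le> b\<close> by (intro Min_le) auto
        also have "\<dots> \<le> A r s"
          using right[OF r, of s] s by (cases "s \<le> b") (auto simp: min_def)
        finally show "u \<le> w" using w by simp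
      qed (use ne in auto)
      also have "\<dots> \<le> (MAX r\<in>{a'..i}. MIN s\<in>{i..b'}. A r s)"
        using r \<open>a' \<le> a\<close> by (intro Max_ge) auto
      finally show "u \<le> (MAX r\<in>{a'..i}. MIN s\<in>{i..b'}. A r s)" .
    qed (use ne in auto)
  qed
  then show ?thesis by (simp add: max_min_avg_def A_def)
qed

lemma continuous_map_Max:
  fixes f :: "'i \<Rightarrow> 'a \<Rightarrow> real"
  assumes "finite A" "A \<noteq> {}" "\<And>i. i \<in> A \<Longrightarrow> continuous_map X euclideanreal (f i)"
  shows "continuous_map X euclideanreal (\<lambda>x. MAX i\<in>A. f i x)"
  using assms
proof (induction rule: finite_ne_induct)
  case (insert i A)
  then show ?case by (simp add: continuous_map_real_max)
qed simp

lemma continuous_map_Min: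
  fixes f :: "'i \<Rightarrow> 'a \<Rightarrow> real"
  assumes "finite A" "A \<noteq> {}" "\<And>i. i \<in> A \<Longrightarrow> continuous_map X euclideanreal (f i)"
  shows "continuous_map X euclideanreal (\<lambda>x. MIN i\<in>A. f i x)"
  using assms
proof (induction rule: finite_ne_induct)
  case (insert i A)
  then show ?case by (simp add: continuous_map_real_min)
qed simp

lemma continuous_map_max_min_avg:
  assumes "a \<le> i" "i \<le> b" and x: "\<And>j. j \<in> {a..b} \<Longrightarrow> continuous_map X euclideanreal (\<lambda>w. x w j)"
  shows "continuous_map X euclideanreal (\<lambda>w. max_min_avg a b (x w) i)"
  unfolding max_min_avg_def
proof (intro continuous_map_Max continuous_map_Min)
  fix r s assume "r \<in> {a..i}" "s \<in> {i..b}"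
  then show "continuous_map X euclideanreal (\<lambda>w. (\<Sum>j=r..s. x w j) / (real s - real r + 1))"
    by (intro continuous_map_real_divide continuous_map_sum x) auto
qed (use assms(1,2) in auto)

section \<open>Gaussian variables and the one-dimensional central limit theorem\<close>

text \<open>For a centred variable the second moment decides between the two alternatives of
  \<open>gaussian_rv\<close>: it is the squared deviation, hence positive, in the normal case and 0
  in the constant case. The existential parameters can thus be replaced by moments.\<close>

lemma gaussian_rv_centered:
  assumes "prob_space N" and "gaussian_rv N G"
  shows "integrable N G" "integrable N (\<lambda>\<omega>. (G \<omega>)\<^sup>2)"
    and "(\<integral>\<omega>. G \<omega> \<partial>N) = 0 \<Longrightarrow> 0 < (\<integral>\<omega>. (G \<omega>)\<^sup>2 \<partial>N) \<Longrightarrow>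
      distributed N lborel G (normal_density 0 (sqrt (\<integral>\<omega>. (G \<omega>)\<^sup>2 \<partial>N)))"
    and "(\<integral>\<omega>. G \<omega> \<partial>N) = 0 \<Longrightarrow> (\<integral>\<omega>. (G \<omega>)\<^sup>2 \<partial>N) = 0 \<Longrightarrow> AE \<omega> in N. G \<omega> = 0"
proof -
  interpret N: prob_space N by fact
  have [measurable]: "G \<in> borel_measurable N"
    using assms(2) by (simp add: gaussian_rv_def)
  obtain \<mu> \<sigma> where "(0 < \<sigma> \<and> distributed N lborel G (normal_density \<mu> \<sigma>)) \<or> (AE \<omega> in N. G \<omega> = \<mu>)"
    using assms(2) by (auto simp: gaussian_rv_def)
  then have "integrable N G \<and> integrable N (\<lambda>\<omega>. (G \<omega>)\<^sup>2) \<and> ((\<integral>\<omega>. G \<omega> \<partial>N) = 0 \<longrightarrow>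
      (0 < (\<integral>\<omega>. (G \<omega>)\<^sup>2 \<partial>N) \<longrightarrow> distributed N lborel G (normal_density 0 (sqrt (\<integral>\<omega>. (G \<omega>)\<^sup>2 \<partial>N)))) \<and>
      ((\<integral>\<omega>. (G \<omega>)\<^sup>2 \<partial>N) = 0 \<longrightarrow> (AE \<omega> in N. G \<omega> = 0)))"
  proof
    assume *: "0 < \<sigma> \<and> distributed N lborel G (normal_density \<mu> \<sigma>)"
    then have \<sigma>: "0 < \<sigma>" and D: "distributed N lborel G (normal_density \<mu> \<sigma>)" by auto
    have int: "integrable N G"
      using distributed_integrable[OF D, of "\<lambda>x. x"] integrable_normal_moment_nz_1[OF \<sigma>] by simp
    have "integrable N (\<lambda>\<omega>. (G \<omega> - \<mu>)\<^sup>2)"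
      using distributed_integrable[OF D, of "\<lambda>x. (x - \<mu>)\<^sup>2"] integrable_normal_moment[OF \<sigma>] by simp
    \<comment> \<open>This is the square of \<open>G\<close> expanded around
      \<open>\<mu>\<close>.\<close>
    then have "integrable N (\<lambda>\<omega>. (G \<omega> - \<mu>)\<^sup>2 + 2 * \<mu> * G \<omega> - \<mu>\<^sup>2)"
      using int by simp
    then have int2: "integrable N (\<lambda>\<omega>. (G \<omega>)\<^sup>2)"
      by (rule Bochner_Integration.integrable_cong[THEN iffD1, OF refl, rotated])
        (simp add: power2_eq_square algebra_simps)
    have "distributed N lborel G (normal_density 0 (sqrt (\<integral>\<omega>. (G \<omega>)\<^sup>2 \<partial>N))) \<and> (\<integral>\<omega>. (G \<omega>)\<^sup>2 \<partial>N) \<noteq> 0"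
      if "(\<integral>\<omega>. G \<omega> \<partial>N) = 0"
    proof -
      have "\<mu> = 0" using N.normal_distributed_expectation[OF \<sigma> D] that by simp
      moreover have "(\<integral>\<omega>. (G \<omega>)\<^sup>2 \<partial>N) = \<sigma>\<^sup>2"
        using N.normal_distributed_variance[OF \<sigma> D] that by simp
      ultimately show ?thesis using D \<sigma> by simp
    qed
    then show ?thesis using int int2 by auto
  next
    assume ae: "AE \<omega> in N. G \<omega> = \<mu>"
    have int: "integrable N G"
      by (rule integrable_cong_AE_imp[of N "\<lambda>_. \<mu>"]) (use ae in auto)
    have int2: "integrable N (\<lambda>\<omega>. (G \<omega>)\<^sup>2)"
      by (rule integrable_cong_AE_imp[of N "\<lambda>_. \<mu>\<^sup>2"]) (use ae in auto)
    have "(\<integral>\<omega>. G \<omega> \<partial>N) = (\<integral>\<omega>. \<mu> \<partial>N)"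
      by (rule integral_cong_AE) (use ae in auto)
    moreover have "(\<integral>\<omega>. (G \<omega>)\<^sup>2 \<partial>N) = (\<integral>\<omega>. \<mu>\<^sup>2 \<partial>N)"
      by (rule integral_cong_AE) (use ae in auto)
    ultimately have "N.expectation G = \<mu>" "(\<integral>\<omega>. (G \<omega>)\<^sup>2 \<partial>N) = \<mu>\<^sup>2"
      by (simp_all add: N.prob_space)
    then show ?thesis using int int2 ae by (cases "\<mu> = 0") auto
  qed
  then show "integrable N G" "integrable N (\<lambda>\<omega>. (G \<omega>)\<^sup>2)"
    "(\<integral>\<omega>. G \<omega> \<partial>N) = 0 \<Longrightarrow> 0 < (\<integral>\<omega>. (G \<omega>)\<^sup>2 \<partial>N) \<Longrightarrow>
      distributed N lborel G (normal_density 0 (sqrt (\<integral>\<omega>. (G \<omega>)\<^sup>2 \<partial>N)))"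
    "(\<integral>\<omega>. G \<omega> \<partial>N) = 0 \<Longrightarrow> (\<integral>\<omega>. (G \<omega>)\<^sup>2 \<partial>N) = 0 \<Longrightarrow> AE \<omega> in N. G \<omega> = 0"
    by auto
qed

text \<open>The observations are numbered from 1, the central limit theorem from 0. Grouping the
  family into the disjoint singleton blocks \<open>{Suc j}\<close> renumbers it while preserving
  independence.\<close>

lemma (in prob_space) indep_vars_Suc:
  assumes "indep_vars (\<lambda>_. S) U {1..}"
  shows "indep_vars (\<lambda>_. S) (\<lambda>i. U (Suc i)) UNIV"
proof -
  have "indep_vars (\<lambda>j. PiM {Suc j} (\<lambda>_. S)) (\<lambda>j \<omega>. restrict (\<lambda>i. U i \<omega>) {Suc j}) UNIV"
    by (rule indep_vars_restrict[OF assms]) (auto simp: disjoint_family_on_def)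
  then have "indep_vars (\<lambda>_. S) (\<lambda>j \<omega>. (restrict (\<lambda>i. U i \<omega>) {Suc j}) (Suc j)) UNIV"
    by (rule indep_vars_compose2[where Y="\<lambda>j x. x (Suc j)"]) (auto intro: measurable_component_singleton)
  then show ?thesis by simp
qed

text \<open>The degenerate case of zero variance is included, since the library's central limit
  theorem excludes it.\<close>
lemma central_limit_gaussian_rv:
  fixes U :: "nat \<Rightarrow> 'a \<Rightarrow> real" and g :: "real \<Rightarrow> real"
  assumes "prob_space M" "prob_space N"
    and indep: "prob_space.indep_vars M (\<lambda>_. borel) U {1..}"
    and distr: "\<And>i. 1 \<le> i \<Longrightarrow> distr M borel (U i) = D"
    and mean: "(\<integral>u. u \<partial>D) = 0" and sq: "integrable D (\<lambda>u. u\<^sup>2)"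
    and G: "gaussian_rv N G" "(\<integral>\<omega>. G \<omega> \<partial>N) = 0" and var: "(\<integral>\<omega>. (G \<omega>)\<^sup>2 \<partial>N) = (\<integral>u. u\<^sup>2 \<partial>D)"
    and g: "continuous_on UNIV g" "bounded (range g)"
  shows "(\<lambda>n. \<integral>\<omega>. g ((\<Sum>i=1..n. U i \<omega>) / sqrt n) \<partial>M) \<longlonglongrightarrow> (\<integral>\<omega>. g (G \<omega>) \<partial>N)"
proof -
  interpret M: prob_space M by fact
  interpret N: prob_space N by fact
  define V where "V = (\<integral>u. u\<^sup>2 \<partial>D)"
  have Um: "U i \<in> borel_measurable M" if "1 \<le> i" for i
    using indep that by (simp add: M.indep_vars_def)
  have [measurable]: "U (Suc i) \<in> borel_measurable M" for i
    by (rule Um) simp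
  have [measurable]: "G \<in> borel_measurable N"
    using G(1) by (simp add: gaussian_rv_def)
  have gm [measurable]: "g \<in> borel_measurable borel"
    using g(1) by (rule borel_measurable_continuous_onI)
  have mean': "M.expectation (U (Suc i)) = 0" for i
    using mean by (simp add: distr[of "Suc i", symmetric] integral_distr)
  have sq': "integrable M (\<lambda>\<omega>. (U (Suc i) \<omega>)\<^sup>2)" for i
    using sq by (simp add: distr[of "Suc i", symmetric] integrable_distr_eq)
  have V': "M.expectation (\<lambda>\<omega>. (U (Suc i) \<omega>)\<^sup>2) = V" for i
    unfolding V_def by (simp add: distr[of "Suc i", symmetric] integral_distr)
  have sums: "(\<Sum>i=1..n. U i \<omega>) = (\<Sum>i<n. U (Suc i) \<omega>)" for n \<omega>
    by (rule sum.reindex_bij_witness[of _ Suc "\<lambda>i. i - 1"]) auto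
  have "0 \<le> V" unfolding V_def by simp
  show ?thesis
  proof (cases "V = 0")
    case True
    \<comment> \<open>With zero variance countably many null sets are discarded together; all sums
      vanish, and both sides equal \<open>g 0\<close>.\<close>
    have "AE \<omega> in M. (U (Suc i) \<omega>)\<^sup>2 = 0" for i
      using integral_nonneg_eq_0_iff_AE[OF sq'[of i]] V'[of i] True by simp
    then have "AE \<omega> in M. \<forall>i. U (Suc i) \<omega> = 0"
      by (simp add: AE_all_countable)
    then have zero: "(\<integral>\<omega>. g ((\<Sum>i=1..n. U i \<omega>) / sqrt n) \<partial>M) = (\<integral>\<omega>. g 0 \<partial>M)" for n
      unfolding sums by (intro integral_cong_AE) auto
    have "AE \<omega> in N. G \<omega> = 0"
      using gaussian_rv_centered(4)[OF \<open>prob_space N\<close> G] var True by (simp add: V_def)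
    then have "(\<integral>\<omega>. g (G \<omega>) \<partial>N) = (\<integral>\<omega>. g 0 \<partial>N)"
      by (intro integral_cong_AE) auto
    then show ?thesis unfolding zero by (simp add: M.prob_space N.prob_space)
  next
    case False
    define \<sigma> where "\<sigma> = sqrt V"
    have \<sigma>: "0 < \<sigma>" and \<sigma>2: "\<sigma>\<^sup>2 = V" using False \<open>0 \<le> V\<close> by (simp_all add: \<sigma>_def)
    let ?S = "\<lambda>n \<omega>. (\<Sum>i<n. U (Suc i) \<omega>) / sqrt (n * \<sigma>\<^sup>2)"
    have weak: "weak_conv_m (\<lambda>n. distr M borel (?S n)) std_normal_distribution"
    proof (rule M.central_limit_theorem_zero_mean)
      show "M.indep_vars (\<lambda>_. borel) (\<lambda>i. U (Suc i)) UNIV"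
        by (rule M.indep_vars_Suc[OF indep])
      show "M.variance (U (Suc i)) = \<sigma>\<^sup>2" for i
        by (simp add: mean' V' \<sigma>2)
      show "distr M borel (U (Suc i)) = D" for i
        by (rule distr) simp
    qed (use mean' sq' \<sigma> in auto)
    obtain B where B: "\<And>x. \<bar>g x\<bar> \<le> B"
      using g(2) by (auto simp: bounded_iff)
    \<comment> \<open>The sums \<open>?S\<close> are normalised to unit variance; testing with
      \<open>g (\<sigma> * y)\<close> puts the scale back without changing the variables.\<close>
    have "(\<lambda>n. \<integral>y. g (\<sigma> * y) \<partial>distr M borel (?S n)) \<longlonglongrightarrow> (\<integral>y. g (\<sigma> * y) \<partial>std_normal_distribution)"
    proof (rule weak_conv_imp_integral_bdd_continuous_conv[OF _ _ weak])
      show "real_distribution (distr M borel (?S n))" for n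
        by (rule M.real_distribution_distr) measurable
      show "real_distribution std_normal_distribution"
        by (rule real_dist_normal_dist)
      show "isCont (\<lambda>y. g (\<sigma> * y)) x" for x
      proof -
        have "continuous_on UNIV (\<lambda>y. g (\<sigma> * y))"
          by (rule continuous_on_compose2[OF g(1)]) (auto intro: continuous_on_mult_left)
        then show ?thesis by (simp add: continuous_on_eq_continuous_at)
      qed
    qed (use B in simp)
    moreover have "(\<integral>y. g (\<sigma> * y) \<partial>distr M borel (?S n)) = (\<integral>\<omega>. g ((\<Sum>i=1..n. U i \<omega>) / sqrt n) \<partial>M)" for n
      unfolding sums using \<sigma> by (simp add: integral_distr real_sqrt_mult)
    moreover have "(\<integral>y. g (\<sigma> * y) \<partial>std_normal_distribution) = (\<integral>\<omega>. g (G \<omega>) \<partial>N)"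
    proof -
      have "distributed N lborel G (normal_density 0 \<sigma>)"
        using gaussian_rv_centered(3)[OF \<open>prob_space N\<close> G] var \<sigma> by (simp add: \<sigma>_def V_def)
      then have D: "distributed N lborel (\<lambda>\<omega>. G \<omega> / \<sigma>) std_normal_density"
        using N.normal_standard_normal_convert[OF \<sigma>, of G 0] by simp
      have "(\<integral>y. g (\<sigma> * y) \<partial>std_normal_distribution) = (\<integral>y. std_normal_density y * g (\<sigma> * y) \<partial>lborel)"
        by (subst integral_density) auto
      also have "\<dots> = (\<integral>\<omega>. g (\<sigma> * (G \<omega> / \<sigma>)) \<partial>N)"
        by (rule distributed_integral[OF D]) auto
      finally show ?thesis using \<sigma> by simp
    qed
    ultimately show ?thesis by simp
  qed
qed

section \<open>Matching second moments\<close>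

text \<open>Distinct disjoint events have indicators with product 0, and an indicator is its own
  square. This yields the multinomial covariance, which is the one prescribed for the Gaussian limit
  at a single time.\<close>

lemma (in prob_space) disjoint_events_combination:
  fixes a :: "'i \<Rightarrow> real"
  assumes A: "\<And>j. j \<in> I \<Longrightarrow> A j \<in> events" and disj: "disjoint_family_on A I"
  defines "h \<equiv> \<lambda>\<omega>. \<Sum>j\<in>I. a j * (indicator (A j) \<omega> - prob (A j))"
  shows "expectation h = 0" "integrable M (\<lambda>\<omega>. (h \<omega>)\<^sup>2)"
    and "expectation (\<lambda>\<omega>. (h \<omega>)\<^sup>2) =
      (\<Sum>j\<in>I. \<Sum>l\<in>I. a j * a l * (prob (A j) * (of_bool (j = l) - prob (A l))))"
proof -
  have int: "integrable M (indicator (A j) :: 'a \<Rightarrow> real)" if "j \<in> I" for j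
    using A[OF that] by (simp add: emeasure_eq_measure)
  have exp: "expectation (indicator (A j)) = prob (A j)" if "j \<in> I" for j
    using A[OF that] by simp
  show "expectation h = 0"
    unfolding h_def using int exp by (simp add: prob_space)
  have prod: "indicator (A j) \<omega> * indicator (A l) \<omega> = (of_bool (j = l) * indicator (A j) \<omega> :: real)"
    if "j \<in> I" "l \<in> I" for j l \<omega>
    using disj that by (cases "j = l") (auto simp: disjoint_family_on_def indicator_def)
  have expand: "a j * (indicator (A j) \<omega> - prob (A j)) * (a l * (indicator (A l) \<omega> - prob (A l))) =
      a j * a l * (of_bool (j = l) * indicator (A j) \<omega> - prob (A j) * indicator (A l) \<omega>
        - prob (A l) * indicator (A j) \<omega> + prob (A j) * prob (A l))" (is "_ = ?t j l \<omega>")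
    if "j \<in> I" "l \<in> I" for j l \<omega>
    unfolding prod[OF that, symmetric] by (simp add: algebra_simps)
  have sq: "(h \<omega>)\<^sup>2 = (\<Sum>j\<in>I. \<Sum>l\<in>I. ?t j l \<omega>)" for \<omega>
    unfolding h_def power2_eq_square sum_product using expand by (intro sum.cong refl)
  have t_int: "integrable M (?t j l)" if "j \<in> I" "l \<in> I" for j l
    using int that by auto
  have t_exp: "expectation (?t j l) = a j * a l * (prob (A j) * (of_bool (j = l) - prob (A l)))"
    if "j \<in> I" "l \<in> I" for j l
    using int that exp by (simp add: prob_space algebra_simps)
  show "integrable M (\<lambda>\<omega>. (h \<omega>)\<^sup>2)"
    unfolding sq using t_int by (intro Bochner_Integration.integrable_sum)
  show "expectation (\<lambda>\<omega>. (h \<omega>)\<^sup>2) =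
      (\<Sum>j\<in>I. \<Sum>l\<in>I. a j * a l * (prob (A j) * (of_bool (j = l) - prob (A l))))"
  proof -
    have "expectation (\<lambda>\<omega>. (h \<omega>)\<^sup>2) = (\<Sum>j\<in>I. expectation (\<lambda>\<omega>. \<Sum>l\<in>I. ?t j l \<omega>))"
      unfolding sq by (intro Bochner_Integration.integral_sum Bochner_Integration.integrable_sum t_int)
    also have "\<dots> = (\<Sum>j\<in>I. \<Sum>l\<in>I. expectation (?t j l))"
      by (intro sum.cong refl Bochner_Integration.integral_sum t_int)
    also have "\<dots> = (\<Sum>j\<in>I. \<Sum>l\<in>I. a j * a l * (prob (A j) * (of_bool (j = l) - prob (A l))))"
      by (intro sum.cong refl t_exp)
    finally show ?thesis .
  qed
qed

text \<open>Products of square-integrable variables are integrable because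
  \<open>\<bar>x * y\<bar>\<close> is at most \<open>x\<^sup>2 + y\<^sup>2\<close>, so the expanded
  square may be integrated term by term.\<close>

lemma second_moment_linear_combination:
  fixes Z :: "'i \<Rightarrow> 'a \<Rightarrow> real"
  assumes Z: "\<And>j. j \<in> I \<Longrightarrow> integrable N (Z j)" "\<And>j. j \<in> I \<Longrightarrow> integrable N (\<lambda>\<omega>. (Z j \<omega>)\<^sup>2)"
  shows "(\<integral>\<omega>. (\<Sum>j\<in>I. a j * Z j \<omega>)\<^sup>2 \<partial>N) = (\<Sum>j\<in>I. \<Sum>l\<in>I. a j * a l * (\<integral>\<omega>. Z j \<omega> * Z l \<omega> \<partial>N))"
proof -
  have prod: "integrable N (\<lambda>\<omega>. a j * a l * (Z j \<omega> * Z l \<omega>))" if "j \<in> I" "l \<in> I" for j l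
  proof -
    have "integrable N (\<lambda>\<omega>. Z j \<omega> * Z l \<omega>)"
    proof (rule Bochner_Integration.integrable_bound)
      show "integrable N (\<lambda>\<omega>. (Z j \<omega>)\<^sup>2 + (Z l \<omega>)\<^sup>2)"
        using Z that by auto
      show "(\<lambda>\<omega>. Z j \<omega> * Z l \<omega>) \<in> borel_measurable N"
        using Z(1)[OF that(1)] Z(1)[OF that(2)] by auto
      have "\<bar>x * y\<bar> \<le> x\<^sup>2 + y\<^sup>2" for x y :: real
        using sum_squares_bound[of "\<bar>x\<bar>" "\<bar>y\<bar>"] mult_nonneg_nonneg[of "\<bar>x\<bar>" "\<bar>y\<bar>"]
        unfolding abs_mult power2_abs by linarith
      then show "AE \<omega> in N. norm (Z j \<omega> * Z l \<omega>) \<le> norm ((Z j \<omega>)\<^sup>2 + (Z l \<omega>)\<^sup>2)"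
        by simp
    qed
    then show ?thesis by simp
  qed
  have "(\<Sum>j\<in>I. a j * Z j \<omega>)\<^sup>2 = (\<Sum>j\<in>I. \<Sum>l\<in>I. a j * a l * (Z j \<omega> * Z l \<omega>))" for \<omega>
    unfolding power2_eq_square sum_product by (intro sum.cong refl) (simp add: ac_simps)
  then show ?thesis
    using prod by (simp add: Bochner_Integration.integral_sum)
qed

section \<open>Tied blocks and divergence of the drift\<close>

text \<open>By monotonicity the indices tied with \<open>i\<close> form an interval: a value between
  \<open>F a t\<close> and \<open>F b t\<close> is squeezed. Outside the interval the inequalities
  are strict, and these gaps are what \<open>sqrt n\<close> amplifies.\<close>

lemma level_set_mono:
  fixes F :: "nat \<Rightarrow> real \<Rightarrow> real"
  assumes mono: "mono_on {1..k} (\<lambda>j. F j t)" and i: "i \<in> {1..k}"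
  defines "a \<equiv> Min (level_set k F t i)" and "b \<equiv> Max (level_set k F t i)"
  shows "1 \<le> a" "a \<le> i" "i \<le> b" "b \<le> k"
    and "\<And>j. j \<in> {a..b} \<Longrightarrow> F j t = F i t"
    and "\<And>j. j \<in> {1..<a} \<Longrightarrow> F j t < F i t"
    and "\<And>j. j \<in> {b<..k} \<Longrightarrow> F i t < F j t"
proof -
  let ?L = "level_set k F t i"
  have fin: "finite ?L" and iL: "i \<in> ?L" and sub: "?L \<subseteq> {1..k}"
    using i by (auto simp: level_set_def)
  have aL: "a \<in> ?L" and bL: "b \<in> ?L"
    unfolding a_def b_def using fin iL by (auto intro!: Min_in Max_in)
  show ai: "a \<le> i" and ib: "i \<le> b"
    unfolding a_def b_def using fin iL by auto
  show a1: "1 \<le> a" and bk: "b \<le> k"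
    using aL bL sub by auto
  have Fab: "F a t = F i t" "F b t = F i t"
    using aL bL by (auto simp: level_set_def)
  show "F j t = F i t" if "j \<in> {a..b}" for j
    using mono_onD[OF mono, of a j] mono_onD[OF mono, of j b] that Fab a1 bk by force
  show "F j t < F i t" if "j \<in> {1..<a}" for j
  proof -
    have "j \<notin> ?L" using that Min_le[OF fin, of j] unfolding a_def by auto
    then have "F j t \<noteq> F i t" using that ai i by (auto simp: level_set_def)
    moreover have "F j t \<le> F i t" using mono_onD[OF mono, of j i] that ai i by auto
    ultimately show ?thesis by simp
  qed
  show "F i t < F j t" if "j \<in> {b<..k}" for j
  proof -
    have "j \<notin> ?L" using that Max_ge[OF fin, of j] unfolding b_def by auto
    then have "F j t \<noteq> F i t" using that ib i by (auto simp: level_set_def)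
    moreover have "F i t \<le> F j t" using mono_onD[OF mono, of i j] that ib i by auto
    ultimately show ?thesis by simp
  qed
qed

text \<open>A drift of size \<open>2 * R\<close> outweighs a perturbation of size at most
  \<open>R\<close> and still leaves the entry beyond \<open>R\<close> or \<open>- R\<close>, as
  localization requires. The gaps are fixed, positive and finite in number, so one \<open>n\<close>
  serves all indices and all \<open>w\<close> in the cube.\<close>

lemma max_min_avg_eventually_localized:
  fixes F :: "nat \<Rightarrow> real \<Rightarrow> real"
  assumes mono: "mono_on {1..k} (\<lambda>j. F j t)" and i: "i \<in> {1..k}"
  shows "\<forall>\<^sub>F n in sequentially. \<forall>w \<in> PiE {1..k} (\<lambda>_. {-R..R}).
      max_min_avg 1 k (\<lambda>j. sqrt (real n) * (F j t - F i t) + w j) i =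
      max_min_avg (Min (level_set k F t i)) (Max (level_set k F t i)) w i"
proof -
  define a b where "a = Min (level_set k F t i)" and "b = Max (level_set k F t i)"
  note L = level_set_mono[of k F t i, OF mono i, folded a_def b_def]
  have sqrt_top: "filterlim (\<lambda>n. sqrt (real n)) at_top sequentially"
    by (intro filterlim_compose[OF sqrt_at_top] filterlim_real_sequentially)
  have grow: "\<forall>\<^sub>F n in sequentially. 2 * R \<le> sqrt (real n) * c" if "0 < c" for c
  proof -
    have "\<forall>\<^sub>F n in sequentially. 2 * R / c \<le> sqrt (real n)"
      using sqrt_top unfolding filterlim_at_top by blast
    then show ?thesis
      by eventually_elim (use that in \<open>simp add: divide_le_eq\<close>)
  qed
  have "\<forall>\<^sub>F n in sequentially. \<forall>j\<in>{1..<a}. 2 * R \<le> sqrt (real n) * (F i t - F j t)"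
    by (intro eventually_ball_finite ballI grow) (simp_all add: L(6))
  moreover have "\<forall>\<^sub>F n in sequentially. \<forall>j\<in>{b<..k}. 2 * R \<le> sqrt (real n) * (F j t - F i t)"
    by (intro eventually_ball_finite ballI grow) (simp_all add: L(7))
  ultimately show ?thesis
    unfolding a_def[symmetric] b_def[symmetric]
  proof eventually_elim
    case (elim n)
    show ?case
    proof
      fix w assume w: "w \<in> PiE {1..k} (\<lambda>_. {-R..R})"
      let ?v = "\<lambda>j. sqrt (real n) * (F j t - F i t) + w j"
      have wR: "-R \<le> w j" "w j \<le> R" if "1 \<le> j" "j \<le> k" for j
        using PiE_mem[OF w, of j] that by auto
      have mid: "?v j = w j" if "j \<in> {a..b}" for j
        using L(5)[OF that] by simp
      have "max_min_avg 1 k ?v i = max_min_avg a b ?v i"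
      proof (rule max_min_avg_localize[where R=R])
        show "\<bar>?v j\<bar> \<le> R" if "j \<in> {a..b}" for j
          unfolding mid[OF that] using wR[of j] that L(1,4) by (simp add: abs_le_iff)
        show "?v j \<le> - R" if "j \<in> {1..<a}" for j
        proof -
          have "2 * R \<le> sqrt (real n) * (F i t - F j t)" using elim(1) that by blast
          moreover have "sqrt (real n) * (F j t - F i t) = - (sqrt (real n) * (F i t - F j t))"
            by (simp add: algebra_simps)
          moreover have "w j \<le> R" using wR[of j] that L(2) i by auto
          ultimately show ?thesis by linarith
        qed
        show "R \<le> ?v j" if "j \<in> {b<..k}" for j
        proof -
          have "2 * R \<le> sqrt (real n) * (F j t - F i t)" using elim(2) that by blast
          moreover have "- R \<le> w j" using wR[of j] that L(3) i by auto
          ultimately show ?thesis by linarith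
        qed
      qed (fact L)+
      also have "\<dots> = max_min_avg a b w i"
        using L(2,3) mid by (rule max_min_avg_cong)
      finally show "max_min_avg 1 k ?v i = max_min_avg a b w i" .
    qed
  qed
qed

section \<open>Convergence of the unrestricted estimators and the restricted ones\<close>

text \<open>A linear combination of the scaled errors is a normalised sum of i.i.d. copies of
  \<open>h (T, \<delta>)\<close>. Its moments are computed on the model space \<open>P\<close>,
  where the events are disjoint because \<open>\<delta>\<close> has one value, and reach the sample
  space \<open>M\<close> through the common law \<open>D\<close>.\<close>

lemma emp_cum_incidence_converges_in_distribution:
  fixes k :: nat
    and P :: "'c measure" and T :: "'c \<Rightarrow> real" and \<delta> :: "'c \<Rightarrow> nat"
    and M :: "'a measure" and Ts :: "nat \<Rightarrow> 'a \<Rightarrow> real" and \<delta>s :: "nat \<Rightarrow> 'a \<Rightarrow> nat"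
    and N :: "'b measure" and Z :: "nat \<Rightarrow> 'b \<Rightarrow> real"
    and F :: "nat \<Rightarrow> real \<Rightarrow> real" and t :: real
  defines "F \<equiv> cum_incidence P T \<delta>"
  assumes "prob_space P" "prob_space M" "prob_space N"
    and T [measurable]: "T \<in> borel_measurable P" and \<delta> [measurable]: "\<delta> \<in> measurable P (count_space UNIV)"
    and indep: "prob_space.indep_vars M (\<lambda>_. borel \<Otimes>\<^sub>M count_space UNIV) (\<lambda>i \<omega>. (Ts i \<omega>, \<delta>s i \<omega>)) {1..}"
    and distr: "\<And>i. i \<ge> 1 \<Longrightarrow>
           distr M (borel \<Otimes>\<^sub>M count_space UNIV) (\<lambda>\<omega>. (Ts i \<omega>, \<delta>s i \<omega>)) =
           distr P (borel \<Otimes>\<^sub>M count_space UNIV) (\<lambda>\<omega>. (T \<omega>, \<delta> \<omega>))"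
    and gauss: "\<And>a. gaussian_rv N (\<lambda>\<omega>. \<Sum>j\<in>{1..k}. a j * Z j \<omega>)"
    and mean: "\<And>j. j \<in> {1..k} \<Longrightarrow> (\<integral>\<omega>. Z j \<omega> \<partial>N) = 0"
    and cov: "\<And>j l. j \<in> {1..k} \<Longrightarrow> l \<in> {1..k} \<Longrightarrow>
           covariance N (Z j) (Z l) = F j t * (of_bool (j = l) - F l t)"
  shows "converges_in_distribution {1..k}
           M (\<lambda>n \<omega>. \<lambda>j\<in>{1..k}. sqrt (real n) * (emp_cum_incidence Ts \<delta>s n j t \<omega> - F j t))
           N (\<lambda>\<omega>. \<lambda>j\<in>{1..k}. Z j \<omega>)"
proof -
  interpret P: prob_space P by fact
  interpret M: prob_space M by fact
  interpret N: prob_space N by fact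
  let ?S = "borel \<Otimes>\<^sub>M count_space UNIV :: (real \<times> nat) measure"
  have pair: "(\<lambda>\<omega>. (Ts i \<omega>, \<delta>s i \<omega>)) \<in> measurable M ?S" if "1 \<le> i" for i
    using indep that by (simp add: M.indep_vars_def)
  have of_bool_meas [measurable]: "(\<lambda>x. of_bool (fst x \<le> t \<and> snd x = j) :: real) \<in> borel_measurable ?S" for j
    by measurable
  have emp: "(\<lambda>\<omega>. of_bool (Ts i \<omega> \<le> t \<and> \<delta>s i \<omega> = j) :: real) \<in> borel_measurable M" if "1 \<le> i" for i j
    using measurable_compose[OF pair[OF that] of_bool_meas] by simp
  have Zj: "gaussian_rv N (Z j)" if "j \<in> {1..k}" for j
  proof -
    have "(\<Sum>l\<in>{1..k}. of_bool (l = j) * Z l \<omega>) = (\<Sum>l\<in>{1..k}. if l = j then Z l \<omega> else 0)" for \<omega>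
      by (intro sum.cong) auto
    then show ?thesis
      using gauss[of "\<lambda>l. of_bool (l = j)"] that by simp
  qed
  have Z_int: "integrable N (Z j)" "integrable N (\<lambda>\<omega>. (Z j \<omega>)\<^sup>2)" if "j \<in> {1..k}" for j
    using gaussian_rv_centered(1,2)[OF \<open>prob_space N\<close> Zj[OF that]] by auto
  define A where "A j = {\<omega> \<in> space P. T \<omega> \<le> t \<and> \<delta> \<omega> = j}" for j
  have A: "A j \<in> sets P" for j
    unfolding A_def by measurable
  have disj: "disjoint_family_on A {1..k}"
    by (auto simp: disjoint_family_on_def A_def)
  have FA: "F j t = P.prob (A j)" for j
    by (simp add: F_def cum_incidence_def A_def)
  show ?thesis
  proof (rule cramer_wold)
    show "(\<lambda>\<omega>. \<lambda>j\<in>{1..k}. sqrt (real n) * (emp_cum_incidence Ts \<delta>s n j t \<omega> - F j t))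
        \<in> measurable M (\<Pi>\<^sub>M i\<in>{1..k}. borel)" for n
      unfolding emp_cum_incidence_def
      by (intro measurable_restrict borel_measurable_times borel_measurable_diff borel_measurable_sum
          borel_measurable_const emp) simp
    show "(\<lambda>\<omega>. \<lambda>j\<in>{1..k}. Z j \<omega>) \<in> measurable N (\<Pi>\<^sub>M i\<in>{1..k}. borel)"
      using Zj by (intro measurable_restrict) (simp add: gaussian_rv_def)
    fix a :: "nat \<Rightarrow> real" and g :: "real \<Rightarrow> real"
    assume g: "continuous_on UNIV g" "bounded (range g)"
    define h where "h x = (\<Sum>j=1..k. a j * (of_bool (fst x \<le> t \<and> snd x = j) - F j t))" for x :: "real \<times> nat"
    have h [measurable]: "h \<in> borel_measurable ?S"
      unfolding h_def by measurable
    define U where "U i \<omega> = h (Ts i \<omega>, \<delta>s i \<omega>)" for i \<omega>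
    define D where "D = distr P borel (\<lambda>\<omega>. h (T \<omega>, \<delta> \<omega>))"
    define G where "G \<omega> = (\<Sum>j\<in>{1..k}. a j * Z j \<omega>)" for \<omega>
    have hP: "h (T \<omega>, \<delta> \<omega>) = (\<Sum>j\<in>{1..k}. a j * (indicator (A j) \<omega> - P.prob (A j)))" if "\<omega> \<in> space P" for \<omega>
      using that by (simp add: h_def FA) (simp add: A_def indicator_def)
    note comb = P.disjoint_events_combination[of "{1..k}" A a, OF A disj]
    have "(\<lambda>n. \<integral>\<omega>. g ((\<Sum>i=1..n. U i \<omega>) / sqrt n) \<partial>M) \<longlonglongrightarrow> (\<integral>\<omega>. g (G \<omega>) \<partial>N)"
    proof (rule central_limit_gaussian_rv[OF \<open>prob_space M\<close> \<open>prob_space N\<close> _ _ _ _ _ _ _ g])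
      show "M.indep_vars (\<lambda>_. borel) U {1..}"
        using M.indep_vars_compose2[OF indep, of "\<lambda>_. h" "\<lambda>_. borel"] by (simp add: U_def[abs_def])
      show "distr M borel (U i) = D" if "1 \<le> i" for i
      proof -
        have "distr M borel (U i) = distr (distr M ?S (\<lambda>\<omega>. (Ts i \<omega>, \<delta>s i \<omega>))) borel h"
          using pair[OF that] by (subst distr_distr) (auto simp: o_def U_def[abs_def])
        also have "\<dots> = distr (distr P ?S (\<lambda>\<omega>. (T \<omega>, \<delta> \<omega>))) borel h"
          using distr[OF that] by simp
        also have "\<dots> = D"
          by (subst distr_distr) (auto simp: o_def D_def)
        finally show ?thesis .
      qed
      have "(\<integral>u. u \<partial>D) = (\<integral>\<omega>. (\<Sum>j\<in>{1..k}. a j * (indicator (A j) \<omega> - P.prob (A j))) \<partial>P)"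
        unfolding D_def using hP by (subst integral_distr) (auto intro!: Bochner_Integration.integral_cong)
      then show "(\<integral>u. u \<partial>D) = 0" using comb(1) by simp
      have "integrable D (\<lambda>u. u\<^sup>2) \<longleftrightarrow>
          integrable P (\<lambda>\<omega>. (\<Sum>j\<in>{1..k}. a j * (indicator (A j) \<omega> - P.prob (A j)))\<^sup>2)"
        unfolding D_def using hP by (subst integrable_distr_eq) (auto intro!: Bochner_Integration.integrable_cong)
      then show "integrable D (\<lambda>u. u\<^sup>2)" using comb(2) by simp
      show "gaussian_rv N G" unfolding G_def by (rule gauss)
      show "(\<integral>\<omega>. G \<omega> \<partial>N) = 0"
        unfolding G_def using Z_int mean by (simp add: Bochner_Integration.integral_sum)
      have "(\<integral>\<omega>. (G \<omega>)\<^sup>2 \<partial>N) = (\<Sum>j\<in>{1..k}. \<Sum>l\<in>{1..k}. a j * a l * (\<integral>\<omega>. Z j \<omega> * Z l \<omega> \<partial>N))"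
        unfolding G_def using Z_int by (rule second_moment_linear_combination)
      also have "\<dots> = (\<Sum>j\<in>{1..k}. \<Sum>l\<in>{1..k}. a j * a l * (P.prob (A j) * (of_bool (j = l) - P.prob (A l))))"
      proof (intro sum.cong refl arg_cong2[where f="(*)"])
        fix j l assume jl: "j \<in> {1..k}" "l \<in> {1..k}"
        show "(\<integral>\<omega>. Z j \<omega> * Z l \<omega> \<partial>N) = P.prob (A j) * (of_bool (j = l) - P.prob (A l))"
          using cov[OF jl] mean jl by (simp add: covariance_def FA)
      qed
      also have "\<dots> = (\<integral>\<omega>. (\<Sum>j\<in>{1..k}. a j * (indicator (A j) \<omega> - P.prob (A j)))\<^sup>2 \<partial>P)"
        using comb(3) by simp
      also have "\<dots> = (\<integral>u. u\<^sup>2 \<partial>D)"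
        unfolding D_def using hP by (subst integral_distr) (auto intro!: Bochner_Integration.integral_cong)
      finally show "(\<integral>\<omega>. (G \<omega>)\<^sup>2 \<partial>N) = (\<integral>u. u\<^sup>2 \<partial>D)" .
    qed
    moreover have "(\<Sum>i=1..n. U i \<omega>) / sqrt n =
        (\<Sum>j\<in>{1..k}. a j * (\<lambda>j\<in>{1..k}. sqrt (real n) * (emp_cum_incidence Ts \<delta>s n j t \<omega> - F j t)) j)" for n \<omega>
    proof -
      have "(\<Sum>i=1..n. U i \<omega>) / sqrt n =
          (\<Sum>j=1..k. a j * ((\<Sum>i=1..n. of_bool (Ts i \<omega> \<le> t \<and> \<delta>s i \<omega> = j) - F j t) / sqrt n))"
        unfolding U_def h_def fst_conv snd_conv
        by (subst sum.swap) (simp add: sum_distrib_left sum_divide_distrib)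
      also have "\<dots> = (\<Sum>j=1..k. a j * (sqrt n * (emp_cum_incidence Ts \<delta>s n j t \<omega> - F j t)))"
      proof (intro sum.cong refl arg_cong2[where f="(*)"])
        fix j
        show "(\<Sum>i=1..n. of_bool (Ts i \<omega> \<le> t \<and> \<delta>s i \<omega> = j) - F j t) / sqrt n =
            sqrt n * (emp_cum_incidence Ts \<delta>s n j t \<omega> - F j t)"
        \<comment> \<open>For \<open>n = 0\<close> both sides are 0, since \<open>sqrt 0 = 0\<close>
          and division by 0 gives 0.\<close>
        proof (cases "n = 0")
          case False
          have "sqrt n * sqrt n = n" by simp
          then show ?thesis using False
            by (simp add: emp_cum_incidence_def sum_subtractf field_simps)
        qed simp
      qed
      finally show ?thesis by simp
    qed
    ultimately show "(\<lambda>n. \<integral>\<omega>. g (\<Sum>j\<in>{1..k}. a j * (\<lambda>j\<in>{1..k}.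
          sqrt (real n) * (emp_cum_incidence Ts \<delta>s n j t \<omega> - F j t)) j) \<partial>M)
        \<longlonglongrightarrow> (\<integral>\<omega>. g (\<Sum>j\<in>{1..k}. a j * (\<lambda>j\<in>{1..k}. Z j \<omega>) j) \<partial>N)"
      by (simp add: G_def)
  qed (fact | simp)+
qed

theorem theorem3p1:
  fixes k :: nat
    and P :: "'c measure" and T :: "'c \<Rightarrow> real" and \<delta> :: "'c \<Rightarrow> nat"
    and M :: "'a measure" and Ts :: "nat \<Rightarrow> 'a \<Rightarrow> real" and \<delta>s :: "nat \<Rightarrow> 'a \<Rightarrow> nat"
    and N :: "'b measure" and Z :: "nat \<Rightarrow> real \<Rightarrow> 'b \<Rightarrow> real"
    and F :: "nat \<Rightarrow> real \<Rightarrow> real" and t :: real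
  defines "F \<equiv> cum_incidence P T \<delta>"
  assumes "k \<ge> 3"
    and "prob_space P"
    and "T \<in> borel_measurable P" and "\<delta> \<in> measurable P (count_space UNIV)"
    and "AE \<omega> in P. 0 \<le> T \<omega>" and "AE \<omega> in P. \<delta> \<omega> \<in> {1..k}"
    and "continuous_on UNIV (cdf (distr P borel T))"
    and "prob_space M"
    and "prob_space.indep_vars M (\<lambda>_. borel \<Otimes>\<^sub>M count_space UNIV) (\<lambda>i \<omega>. (Ts i \<omega>, \<delta>s i \<omega>)) {1..}"
    and "\<And>i. i \<ge> 1 \<Longrightarrow>
           distr M (borel \<Otimes>\<^sub>M count_space UNIV) (\<lambda>\<omega>. (Ts i \<omega>, \<delta>s i \<omega>)) =
           distr P (borel \<Otimes>\<^sub>M count_space UNIV) (\<lambda>\<omega>. (T \<omega>, \<delta> \<omega>))"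
    and "prob_space N"
    and "gaussian_process N ({1..k} \<times> {0..}) (\<lambda>(i, s). Z i s)"
    and "\<And>i s. i \<in> {1..k} \<Longrightarrow> 0 \<le> s \<Longrightarrow> (\<integral>\<omega>. Z i s \<omega> \<partial>N) = 0"
    and "\<And>i j s u. i \<in> {1..k} \<Longrightarrow> j \<in> {1..k} \<Longrightarrow> 0 \<le> s \<Longrightarrow> s \<le> u \<Longrightarrow>
           covariance N (Z i s) (Z j u) = F i s * (of_bool (i = j) - F j u)"
    and "\<And>i j s. 1 \<le> i \<Longrightarrow> i \<le> j \<Longrightarrow> j \<le> k \<Longrightarrow> 0 \<le> s \<Longrightarrow> F i s \<le> F j s"
    and "0 \<le> t"
  shows "converges_in_distribution {1..k}
           M (\<lambda>n \<omega>. \<lambda>i\<in>{1..k}. sqrt (real n) * (restricted_estimator k Ts \<delta>s n i t \<omega> - F i t))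
           N (\<lambda>\<omega>. \<lambda>i\<in>{1..k}. limit_variable k F Z i t \<omega>)"
proof -
  let ?I = "{1..k}"
  let ?X = "\<lambda>n \<omega>. \<lambda>j\<in>?I. sqrt (real n) * (emp_cum_incidence Ts \<delta>s n j t \<omega> - F j t)"
  let ?a = "\<lambda>i. Min (level_set k F t i)" and ?b = "\<lambda>i. Max (level_set k F t i)"
  \<comment> \<open>Each coordinate has its own centring \<open>F i t\<close>, so the drift is zero
    exactly on the block tied with that coordinate.\<close>
  define \<phi> where "\<phi> n w = (\<lambda>i\<in>?I. max_min_avg 1 k (\<lambda>j. sqrt (real n) * (F j t - F i t) + w j) i)"
    for n and w :: "nat \<Rightarrow> real"
  define \<psi> where "\<psi> w = (\<lambda>i\<in>?I. max_min_avg (?a i) (?b i) w i)" for w :: "nat \<Rightarrow> real"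
  have mono: "mono_on ?I (\<lambda>j. F j t)"
  proof (rule mono_onI)
    fix i j assume "i \<in> ?I" "j \<in> ?I" "i \<le> j"
    then show "F i t \<le> F j t" by (intro assms(16)) (use \<open>0 \<le> t\<close> in simp_all)
  qed
  note L = level_set_mono[of k F t, OF mono]
  have gauss: "gaussian_rv N (\<lambda>\<omega>. \<Sum>j\<in>?I. a j * Z j t \<omega>)" for a
  proof -
    \<comment> \<open>The Gaussian process is indexed by pairs; the slice at time \<open>t\<close>
      is a finite index set for which the definition gives all linear combinations.\<close>
    have "?I \<times> {t} \<subseteq> ?I \<times> {0..}" using \<open>0 \<le> t\<close> by auto
    then have "gaussian_rv N (\<lambda>\<omega>. \<Sum>p\<in>?I \<times> {t}. a (fst p) * (case p of (i, s) \<Rightarrow> Z i s) \<omega>)"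
      using assms(13) unfolding gaussian_process_def
      by (elim allE[of _ "?I \<times> {t}"] allE[of _ "\<lambda>p. a (fst p)"]) simp
    moreover have "(\<Sum>p\<in>?I \<times> {t}. a (fst p) * (case p of (i, s) \<Rightarrow> Z i s) \<omega>) = (\<Sum>j\<in>?I. a j * Z j t \<omega>)" for \<omega>
      by (rule sum.reindex_bij_witness[of _ "\<lambda>j. (j, t)" fst]) auto
    ultimately show ?thesis by simp
  qed
  have conv: "converges_in_distribution ?I M ?X N (\<lambda>\<omega>. \<lambda>j\<in>?I. Z j t \<omega>)"
    unfolding F_def
  proof (rule emp_cum_incidence_converges_in_distribution[OF assms(3,9,12,4,5,10,11) gauss])
    show "covariance N (Z j t) (Z l t) = cum_incidence P T \<delta> j t * (of_bool (j = l) - cum_incidence P T \<delta> l t)"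
      if "j \<in> ?I" "l \<in> ?I" for j l
      using assms(15)[OF that \<open>0 \<le> t\<close> order_refl] by (simp only: F_def)
  qed (use assms(14) \<open>0 \<le> t\<close> in simp_all)
  have "converges_in_distribution ?I M (\<lambda>n \<omega>. \<phi> n (?X n \<omega>)) N (\<lambda>\<omega>. \<psi> (\<lambda>j\<in>?I. Z j t \<omega>))"
  proof (rule converges_in_distribution_map[OF \<open>prob_space M\<close> \<open>prob_space N\<close> _ conv])
    have coord: "continuous_map (powertop_real ?I) euclideanreal (\<lambda>w. w j)" if "j \<in> ?I" for j
      using that by (rule continuous_map_product_projection)
    show "continuous_map (powertop_real ?I) (powertop_real ?I) (\<phi> n)" for n
      unfolding continuous_map_componentwise
    proof (intro conjI ballI)
      fix i assume i: "i \<in> ?I"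
      have "continuous_map (powertop_real ?I) euclideanreal
          (\<lambda>w. max_min_avg 1 k (\<lambda>j. sqrt (real n) * (F j t - F i t) + w j) i)"
        using i by (intro continuous_map_max_min_avg continuous_map_add coord) auto
      then show "continuous_map (powertop_real ?I) euclideanreal (\<lambda>w. \<phi> n w i)"
        using i by (simp add: \<phi>_def)
    qed (auto simp: \<phi>_def)
    show "continuous_map (powertop_real ?I) (powertop_real ?I) \<psi>"
      unfolding continuous_map_componentwise
    proof (intro conjI ballI)
      fix i assume i: "i \<in> ?I"
      have "continuous_map (powertop_real ?I) euclideanreal (\<lambda>w. max_min_avg (?a i) (?b i) w i)"
        using L(1-4)[OF i] by (intro continuous_map_max_min_avg coord) auto
      then show "continuous_map (powertop_real ?I) euclideanreal (\<lambda>w. \<psi> w i)"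
        using i by (simp add: \<psi>_def)
    qed (auto simp: \<psi>_def)
    show "\<forall>\<^sub>F n in sequentially. \<forall>w\<in>PiE ?I (\<lambda>_. {-R..R}). \<phi> n w = \<psi> w" for R
    proof -
      have "\<forall>\<^sub>F n in sequentially. \<forall>i\<in>?I. \<forall>w\<in>PiE ?I (\<lambda>_. {-R..R}).
          max_min_avg 1 k (\<lambda>j. sqrt (real n) * (F j t - F i t) + w j) i = max_min_avg (?a i) (?b i) w i"
        by (intro eventually_ball_finite ballI max_min_avg_eventually_localized mono) auto
      then show ?thesis
        by eventually_elim (auto simp: \<phi>_def \<psi>_def intro!: restrict_ext)
    qed
  qed simp
  moreover have "\<phi> n (?X n \<omega>) = (\<lambda>i\<in>?I. sqrt (real n) * (restricted_estimator k Ts \<delta>s n i t \<omega> - F i t))" for n \<omega>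
    unfolding \<phi>_def
  proof (rule restrict_ext)
    fix i assume i: "i \<in> ?I"
    \<comment> \<open>The same affine map, with \<open>c = sqrt n\<close> and
      \<open>d = F i t\<close>, acts on all entries; the next step then splits each entry into its
      drift and its own scaled error.\<close>
    have "sqrt (real n) * (restricted_estimator k Ts \<delta>s n i t \<omega> - F i t) =
        max_min_avg 1 k (\<lambda>j. sqrt (real n) * (emp_cum_incidence Ts \<delta>s n j t \<omega> - F i t)) i"
      unfolding restricted_estimator_def using i by (intro max_min_avg_affine) auto
    also have "\<dots> = max_min_avg 1 k (\<lambda>j. sqrt (real n) * (F j t - F i t) + ?X n \<omega> j) i"
      using i by (intro max_min_avg_cong) (auto simp: algebra_simps)
    finally show "max_min_avg 1 k (\<lambda>j. sqrt (real n) * (F j t - F i t) + ?X n \<omega> j) i =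
        sqrt (real n) * (restricted_estimator k Ts \<delta>s n i t \<omega> - F i t)" ..
  qed
  moreover have "\<psi> (\<lambda>j\<in>?I. Z j t \<omega>) = (\<lambda>i\<in>?I. limit_variable k F Z i t \<omega>)" for \<omega>
    unfolding \<psi>_def limit_variable_def
  proof (rule restrict_ext)
    fix i assume i: "i \<in> ?I"
    show "max_min_avg (?a i) (?b i) (\<lambda>j\<in>?I. Z j t \<omega>) i = max_min_avg (?a i) (?b i) (\<lambda>j. Z j t \<omega>) i"
      using L(1-4)[OF i] by (intro max_min_avg_cong) auto
  qed
  ultimately show ?thesis by simp
qed

end
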